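(* Let $E$ be a Borel state space and $K$ a two-point transition kernel on $E$. Suppose that, for some integers $l\ge1$ and $d\ge2$ and some family $\mathcal S=\{s_m: m=0,1,\dots,(d-1)l\}$ of coupling functions for $K$, the following holds: there exists a binary ($\{0,1\}$-valued) field $W_{h,k}=\psi(\mathbf U_{R_{h,k}})$, $(h,k)\in\mathcal V_d$, with $$P(W_{h,k}=0)=\tilde\delta>\frac{d-1}{d},$$ such that $\{W_{h,k}=0\}$ implies $F^{\mathcal S}(\mathbf U_{R_{h,k}};\mathbf x)=\Phi(\mathbf U_{R_{h,k}})$ for all $\mathbf x\in E^{\overrightarrow{\partial}R_{h,k}}$, for some measurable function $\Phi$. Then $K$ is uniformly ergodic, and for any finite region $\Lambda\subset\mathbb Z^2$ (such that $\partial_I\Lambda$ is a union of blocks $B_{h,k}$) the law of its stationary version $\mathbf X'_\Lambda$ (the restriction to $\Lambda$ of the equilibrium field of $K$) is the same as that of $\Upsilon^{D(\Lambda)}(\mathbf U_{D(\Lambda)})$ (restricted to the sites of $\Lambda$). Moreover $$\mathbb E|D(\Lambda)|=|\Lambda|+O(|\partial_I\Lambda|).$$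
   Context: **Kernels and fields.** A Borel state space $E$ is a Borel subset of a Polish space with its Borel $\sigma$-algebra. A two-point transition kernel is a map $K:E^2\to\mathcal P(E)$, with $\mathcal P(E)$ the set of probability measures on $E$, such that $(x,y)\mapsto K(B\mid x,y)=K(x,y)(B)$ is measurable for every measurable $B\subset E$. Let $\mathbb N^+=\{1,2,\dots\}$, $\Lambda_{m,n}=\{1,\dots,m\}\times\{1,\dots,n\}$. For boundary conditions $\mathbf x=\{x_{i,0},x_{0,i}:i\in\mathbb N^+\}$ in $E$, the unilateral field $\mathbf X^{\mathbf x}$ on $(\mathbb N^+)^2$ has $P(\mathbf X^{\mathbf x}_{\Lambda_{m,n}}\in B)=\int_B\prod_{i=1}^m\prod_{j=1}^nK(dx_{i,j}\mid x_{i-1,j},x_{i,j-1})$ for all $m,n$ and measurable $B\subset E^{m\times n}$. **Uniform ergodicity.** $K$ is uniformly ergodic if there is a stationary (translation invariant) $E$-valued field $\mathbf X'=\{X'_{i,j}\}_{i,j\ge0}$ such that for every pair $(m,n)$, $\lim_{(h,l)\to\infty}\|\mathcal L(\mathbf X^{\mathbf x}_{(h,l)+\Lambda_{m,n}})-\mathcal L(\mathbf X'_{\Lambda_{m,n}})\|=0$ uniformly in the boundary conditions $\mathbf x$, where $\mathcal L$ denotes law and $\|\cdot\|$ is total variation. $\mathbf X'$, extended to a stationary field on $\mathbb Z^2$, is the equilibrium field (stationary version) of $K$; it is unique in law. **Boundaries.** The parents of $(i,j)\in\mathbb Z^2$ are $(i-1,j)$ and $(i,j-1)$. For $S\subset\mathbb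 Z^2$, $\overrightarrow{\partial}S$ is the set of parents of elements of $S$ not in $S$; $\partial_IS$ is the set of vertices of $S$ with at least one parent in $\overrightarrow{\partial}S$. **Blocks and graph.** Fix $l\ge1$, $d\ge2$. $\mathcal V_d=\{(h,k)\in\mathbb Z^2: h+k\equiv0\bmod (d-1)\}$. $B_{0,0}=\{(1,l),(2,l-1),\dots,(l,1)\}$ and $B_{h,k}=B_{0,0}+(hl,kl)$ for $(h,k)\in\mathcal V_d$. The oriented graph $\mathcal G_d$ has the blocks as vertices, identified with the elements of $\mathcal V_d$; an oriented edge connects $(h,k)$ with $(h+i,k+d-1-i)$ for $i=0,\dots,d-1$, so the $d$ parents of $(h,k)$ in $\mathcal G_d$ are $(h-i,k+i-d+1)$, $i=0,\dots,d-1$. Put $$R_{h,k}=\{(i,j)\in\mathbb Z^2: i\le l(h+1),\ j\le l(k+1),\ (h+k-d+2)l+2\le i+j\le(h+k+1)l+1\};$$ then $B_{h,k}\subset R_{h,k}$ and $\overrightarrow{\partial}R_{h,k}=\bigcup_{i=0}^{d-1}B_{h-i,k+i-d+1}$. **Coupling functions.** A family $\mathcal S=\{s_m\}_{m=0}^{(d-1)l}$ of coupling functions for $K$ consists of functions $s_m:(0,1)\times E^2\to E$, separately measurable in each of their arguments, with $s_m(U;x_1,x_2)\sim K(\cdot\mid x_1,x_2)$ for all $x_1,x_2\in E$ when $U$ is uniform on $(0,1)$. Let $\mathbf U=\{U_{i,j}\}_{(i,j)\in\mathbb Z^2}$ be i.i.d. uniform on $(0,1)$ and $m(i,j)=(i+j-l-1)\bmod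 (d-1)l$. For finite $S\subset\mathbb Z^2$ and $\mathbf x\in E^{\overrightarrow{\partial}S}$, the field $\mathbf X^{\mathbf x}_S$ with kernel $K$ and boundary condition $\mathbf x$ is constructed by the recursion $$X^{\mathbf x}_{i,j}=s_{m(i,j)}(U_{i,j};X^{\mathbf x}_{i-1,j},X^{\mathbf x}_{i,j-1}),\quad (i,j)\in S,\qquad X^{\mathbf x}_{\overrightarrow{\partial}S}=\mathbf x,$$ along any total order of $S$ in which each site comes after its parents. For $S=R_{h,k}$, the resulting configuration on $B_{h,k}$ is denoted $F^{\mathcal S}(\mathbf U_{R_{h,k}};\mathbf x)$. **The function $\Upsilon$.** If $B\subset S$, with $S\subset\mathbb Z^2$ finite, is such that $\partial_IB$ is contained in a union of blocks $B_{h,k}$ where $W_{h,k}=0$, then the restriction of $\mathbf X^{\mathbf x}_S$ to $B$ is represented as a measurable function $\Upsilon^B(\mathbf U_B)$, irrespective of the boundary conditions $\mathbf x$ on $\overrightarrow{\partial}S$. **The random region.** An increasing path of length $m$ in $\mathcal G_d$ is a sequence $v_0,\dots,v_m\in\mathcal V_d$ with $v_k$ a parent of $v_{k+1}$ for $k=0,\dots,m-1$; it is open if $W_{v_k}=1$ for $k=1,\dots,m$ (no requirement on $v_0$). For finite $\Lambda$ with $\partial_I\Lambda$ a union of blocks (hence identified with a subset of $\mathcal V_d$), $\sigma(\Lambda)$ is the set of $v\in\mathcal V_d$ from which there is an open path in $\mathcal G_d$ to some element of $\partial_I\Lambda$, and $D(\Lambda)=\Lambda\cup\sigma(\Lambda)$,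 with elements of $\mathcal V_d$ identified with blocks. One has $W_{h,k}=0$ for every $(h,k)\in\partial_ID(\Lambda)$.
   Formalization: The coupling functions are also assumed to make each finite field X^x_S measurable in U_S (separate measurability alone does not), and Υ^{D(Λ)} uses the variables U on the regions R_{h,k} of the blocks in D(Λ), not only those at the sites of D(Λ). *)

theory Defs
  imports "HOL-Probability.Probability"
begin

type_synonym site = "int \<times> int"

section \<open>Kernels and unilateral fields\<close>

abbreviation state_space :: "'a::topological_space set \<Rightarrow> 'a measure" where
  "state_space E \<equiv> restrict_space borel E"

text \<open>\<open>K (x, y)\<close> is the measure \<open>K(\<cdot> | x, y)\<close>. Membership in \<open>prob_algebra\<close> says that every
  \<open>K (x, y)\<close> is a probability measure on \<open>E\<close>; measurability into it says that
  \<open>(x, y) \<mapsto> K(B | x, y)\<close> is measurable for every measurable \<open>B\<close>.\<close>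

definition transition_kernel :: "'a::polish_space set \<Rightarrow> ('a \<times> 'a \<Rightarrow> 'a measure) \<Rightarrow> bool" where
  "transition_kernel E K \<longleftrightarrow>
     K \<in> state_space E \<Otimes>\<^sub>M state_space E \<rightarrow>\<^sub>M prob_algebra (state_space E)"

definition rect :: "int \<Rightarrow> int \<Rightarrow> site set" where
  "rect m n = {1..m} \<times> {1..n}"

definition rect_sites :: "int \<Rightarrow> int \<Rightarrow> site list" where
  "rect_sites m n = [(i, j). i \<leftarrow> [1..m], j \<leftarrow> [1..n]]"

text \<open>The iterated integral of \<open>f\<close> against the product of the \<open>K(dx\<^sub>i\<^sub>j | x\<^sub>i\<^sub>-\<^sub>1\<^sub>j, x\<^sub>i\<^sub>j\<^sub>-\<^sub>1)\<close>
  over the listed sites; the outermost integral is over the first site of the list, and the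
  last argument supplies the values at sites that are not integrated over.\<close>

fun kernel_integral ::
  "('a \<times> 'a \<Rightarrow> 'a measure) \<Rightarrow> site list \<Rightarrow> ((site \<Rightarrow> 'a) \<Rightarrow> ennreal) \<Rightarrow> (site \<Rightarrow> 'a) \<Rightarrow> ennreal" where
  "kernel_integral K [] f x = f x"
| "kernel_integral K ((i, j) # ts) f x =
     (\<integral>\<^sup>+ y. kernel_integral K ts f (x((i, j) := y)) \<partial>K (x (i - 1, j), x (i, j - 1)))"

definition unilateral_law ::
  "'a::polish_space set \<Rightarrow> ('a \<times> 'a \<Rightarrow> 'a measure) \<Rightarrow> (site \<Rightarrow> 'a) \<Rightarrow> int \<Rightarrow> int \<Rightarrow> (site \<Rightarrow> 'a) measure" where
  "unilateral_law E K x m n =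
     measure_of (space (PiM (rect m n) (\<lambda>_. state_space E))) (sets (PiM (rect m n) (\<lambda>_. state_space E)))
       (\<lambda>A. kernel_integral K (rect_sites m n) (\<lambda>y. indicator A (restrict y (rect m n))) x)"

text \<open>A configuration on the translate of \<open>A\<close> by \<open>v\<close>, read as a configuration on \<open>A\<close>.\<close>

definition translate :: "site \<Rightarrow> site set \<Rightarrow> (site \<Rightarrow> 'b) \<Rightarrow> site \<Rightarrow> 'b" where
  "translate v A y = (\<lambda>t\<in>A. y (t + v))"

definition unilateral_window_law ::
  "'a::polish_space set \<Rightarrow> ('a \<times> 'a \<Rightarrow> 'a measure) \<Rightarrow> (site \<Rightarrow> 'a) \<Rightarrow> site \<Rightarrow> int \<Rightarrow> int \<Rightarrow> (site \<Rightarrow> 'a) measure" where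
  "unilateral_window_law E K x v m n =
     distr (unilateral_law E K x (fst v + m) (snd v + n)) (PiM (rect m n) (\<lambda>_. state_space E))
       (translate v (rect m n))"

section \<open>Uniform ergodicity\<close>

definition tv_dist :: "'b measure \<Rightarrow> 'b measure \<Rightarrow> real" where
  "tv_dist \<mu> \<nu> = (SUP A\<in>sets \<mu>. \<bar>measure \<mu> A - measure \<nu> A\<bar>)"

text \<open>Laws of stationary fields indexed by \<open>A\<close>; used for the quadrant and for the whole lattice.\<close>

definition stationary_law :: "'a::polish_space set \<Rightarrow> site set \<Rightarrow> (site \<Rightarrow> 'a) measure \<Rightarrow> bool" where
  "stationary_law E A \<mu> \<longleftrightarrow>
     prob_space \<mu> \<and> sets \<mu> = sets (PiM A (\<lambda>_. state_space E)) \<and>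
     (\<forall>v. (\<lambda>t. t + v) ` A \<subseteq> A \<longrightarrow> distr \<mu> (PiM A (\<lambda>_. state_space E)) (translate v A) = \<mu>)"

definition quadrant :: "site set" where
  "quadrant = {0..} \<times> {0..}"

definition axes :: "site set" where
  "axes = {1..} \<times> {0} \<union> {0} \<times> {1..}"

definition limit_law :: "'a::polish_space set \<Rightarrow> ('a \<times> 'a \<Rightarrow> 'a measure) \<Rightarrow> (site \<Rightarrow> 'a) measure \<Rightarrow> bool" where
  "limit_law E K \<mu> \<longleftrightarrow> stationary_law E quadrant \<mu> \<and>
     (\<forall>m\<ge>1. \<forall>n\<ge>1.
        uniform_limit (axes \<rightarrow>\<^sub>E E)
          (\<lambda>v x. tv_dist (unilateral_window_law E K x v m n)
             (distr \<mu> (PiM (rect m n) (\<lambda>_. state_space E)) (\<lambda>y. restrict y (rect m n))))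
          (\<lambda>_. 0) (at_top \<times>\<^sub>F at_top))"

definition uniformly_ergodic :: "'a::polish_space set \<Rightarrow> ('a \<times> 'a \<Rightarrow> 'a measure) \<Rightarrow> bool" where
  "uniformly_ergodic E K \<longleftrightarrow> (\<exists>\<mu>. limit_law E K \<mu>)"

definition equilibrium_law :: "'a::polish_space set \<Rightarrow> ('a \<times> 'a \<Rightarrow> 'a measure) \<Rightarrow> (site \<Rightarrow> 'a) measure \<Rightarrow> bool" where
  "equilibrium_law E K \<mu> \<longleftrightarrow> stationary_law E UNIV \<mu> \<and>
     limit_law E K (distr \<mu> (PiM quadrant (\<lambda>_. state_space E)) (\<lambda>y. restrict y quadrant))"

section \<open>Boundaries and blocks\<close>

fun parents :: "site \<Rightarrow> site set" where
  "parents (i, j) = {(i - 1, j), (i, j - 1)}"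

definition outer_bdry :: "site set \<Rightarrow> site set" where
  "outer_bdry S = (\<Union>t\<in>S. parents t) - S"

definition inner_bdry :: "site set \<Rightarrow> site set" where
  "inner_bdry S = {t \<in> S. parents t \<inter> outer_bdry S \<noteq> {}}"

definition V :: "int \<Rightarrow> site set" where
  "V d = {(h, k). (d - 1) dvd (h + k)}"

definition offset :: "int \<Rightarrow> site \<Rightarrow> site" where
  "offset l v = (fst v * l, snd v * l)"

definition block :: "int \<Rightarrow> site \<Rightarrow> site set" where
  "block l v = (\<lambda>t. t + offset l v) ` {(i, l + 1 - i) | i. 1 \<le> i \<and> i \<le> l}"

definition union_of_blocks :: "int \<Rightarrow> int \<Rightarrow> site set \<Rightarrow> bool" where
  "union_of_blocks l d T \<longleftrightarrow> (\<exists>A\<subseteq>V d. T = (\<Union>v\<in>A. block l v))"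

fun region :: "int \<Rightarrow> int \<Rightarrow> site \<Rightarrow> site set" where
  "region l d (h, k) =
     {(i, j). i \<le> l * (h + 1) \<and> j \<le> l * (k + 1) \<and>
        (h + k - d + 2) * l + 2 \<le> i + j \<and> i + j \<le> (h + k + 1) * l + 1}"

fun graph_parents :: "int \<Rightarrow> site \<Rightarrow> site set" where
  "graph_parents d (h, k) = {(h - i, k + i - d + 1) | i. 0 \<le> i \<and> i \<le> d - 1}"

section \<open>Coupling functions and the recursive construction\<close>

definition unif01 :: "real measure" where
  "unif01 = restrict_space lborel {0<..<1}"

text \<open>Only separate measurability is required here. It does not make the compositions formed by
  \<open>field\<close> below measurable in the uniform variables, so that has to be assumed wherever
  \<open>field\<close> is meant to be a random field; joint measurability of the \<open>s m\<close> would imply it.\<close>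

definition coupling_functions ::
  "'a::polish_space set \<Rightarrow> ('a \<times> 'a \<Rightarrow> 'a measure) \<Rightarrow> int \<Rightarrow> int \<Rightarrow> (int \<Rightarrow> real \<Rightarrow> 'a \<Rightarrow> 'a \<Rightarrow> 'a) \<Rightarrow> bool" where
  "coupling_functions E K l d s \<longleftrightarrow>
     (\<forall>m\<in>{0..(d - 1) * l}.
        (\<forall>x\<in>E. \<forall>y\<in>E. (\<lambda>u. s m u x y) \<in> unif01 \<rightarrow>\<^sub>M state_space E) \<and>
        (\<forall>u\<in>{0<..<1}. \<forall>y\<in>E. (\<lambda>x. s m u x y) \<in> state_space E \<rightarrow>\<^sub>M state_space E) \<and>
        (\<forall>u\<in>{0<..<1}. \<forall>x\<in>E. (\<lambda>y. s m u x y) \<in> state_space E \<rightarrow>\<^sub>M state_space E) \<and>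
        (\<forall>x\<in>E. \<forall>y\<in>E. distr unif01 (state_space E) (\<lambda>u. s m u x y) = K (x, y)))"

text \<open>The field with boundary condition \<open>x\<close> driven by \<open>u\<close>. Finiteness of \<open>S\<close> is tested only to
  make the recursion terminate; for infinite \<open>S\<close> the value is meaningless.\<close>

function field ::
  "(int \<Rightarrow> real \<Rightarrow> 'a \<Rightarrow> 'a \<Rightarrow> 'a) \<Rightarrow> int \<Rightarrow> int \<Rightarrow> site set \<Rightarrow> (site \<Rightarrow> 'a) \<Rightarrow> (site \<Rightarrow> real) \<Rightarrow> site \<Rightarrow> 'a" where
  "field s l d S x u (i, j) =
     (if finite S \<and> (i, j) \<in> S
      then s ((i + j - l - 1) mod ((d - 1) * l)) (u (i, j))
             (field s l d S x u (i - 1, j)) (field s l d S x u (i, j - 1))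
      else x (i, j))"
  by pat_completeness auto
termination
proof (relation "Wellfounded.measure (\<lambda>(s, l, d, S, x, u, t). card {r \<in> S. fst r + snd r \<le> fst t + snd t})", goal_cases)
  case 1
  then show ?case by simp
next
  case (2 s l d S x u i j)
  then have "(i, j) \<in> {r \<in> S. fst r + snd r \<le> i + j} - {r \<in> S. fst r + snd r \<le> i - 1 + j}"
    by simp
  moreover have "{r \<in> S. fst r + snd r \<le> i - 1 + j} \<subseteq> {r \<in> S. fst r + snd r \<le> i + j}"
    by auto
  ultimately have "{r \<in> S. fst r + snd r \<le> i - 1 + j} \<subset> {r \<in> S. fst r + snd r \<le> i + j}"
    by blast
  then have "card {r \<in> S. fst r + snd r \<le> i - 1 + j} < card {r \<in> S. fst r + snd r \<le> i + j}"
    using 2 by (intro psubset_card_mono) auto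
  then show ?case by simp
next
  case (3 s l d S x u i j)
  then have "(i, j) \<in> {r \<in> S. fst r + snd r \<le> i + j} - {r \<in> S. fst r + snd r \<le> i + (j - 1)}"
    by simp
  moreover have "{r \<in> S. fst r + snd r \<le> i + (j - 1)} \<subseteq> {r \<in> S. fst r + snd r \<le> i + j}"
    by auto
  ultimately have "{r \<in> S. fst r + snd r \<le> i + (j - 1)} \<subset> {r \<in> S. fst r + snd r \<le> i + j}"
    by blast
  then have "card {r \<in> S. fst r + snd r \<le> i + (j - 1)} < card {r \<in> S. fst r + snd r \<le> i + j}"
    using 3 by (intro psubset_card_mono) auto
  then show ?case by simp
qed

definition block_map ::
  "(int \<Rightarrow> real \<Rightarrow> 'a \<Rightarrow> 'a \<Rightarrow> 'a) \<Rightarrow> int \<Rightarrow> int \<Rightarrow> site \<Rightarrow> (site \<Rightarrow> real) \<Rightarrow> (site \<Rightarrow> 'a) \<Rightarrow> site \<Rightarrow> 'a" where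
  "block_map s l d v u x = restrict (field s l d (region l d v) x u) (block l v)"

section \<open>The random region and the equilibrium configuration\<close>

definition open_path :: "int \<Rightarrow> (site \<Rightarrow> nat) \<Rightarrow> site \<Rightarrow> site \<Rightarrow> bool" where
  "open_path d w v v' \<longleftrightarrow>
     (\<exists>m p. p 0 = v \<and> p m = v' \<and> (\<forall>k\<le>m. p k \<in> V d) \<and>
        (\<forall>k<m. p k \<in> graph_parents d (p (Suc k))) \<and> (\<forall>k\<in>{1..m}. w (p k) = 1))"

definition \<sigma> :: "int \<Rightarrow> int \<Rightarrow> (site \<Rightarrow> nat) \<Rightarrow> site set \<Rightarrow> site set" where
  "\<sigma> l d w \<Lambda> = {v \<in> V d. \<exists>v'\<in>V d. block l v' \<subseteq> inner_bdry \<Lambda> \<and> open_path d w v v'}"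

definition D :: "int \<Rightarrow> int \<Rightarrow> (site \<Rightarrow> nat) \<Rightarrow> site set \<Rightarrow> site set" where
  "D l d w \<Lambda> = \<Lambda> \<union> (\<Union>v\<in>\<sigma> l d w \<Lambda>. block l v)"

text \<open>A block \<open>v\<close> carries the variables \<open>\<^bold>U\<close> on its whole region \<open>region l d v\<close>: these determine
  \<open>W\<^sub>v\<close> and, when \<open>W\<^sub>v = 0\<close>, the configuration on the block. Accordingly the sites whose
  variables are available from a union \<open>B\<close> of sites and blocks form the set \<open>carried_sites l d B\<close>.
  If \<open>l = 1\<close> and \<open>d = 2\<close> then \<open>carried_sites l d B = B\<close>.\<close>

definition carried_sites :: "int \<Rightarrow> int \<Rightarrow> site set \<Rightarrow> site set" where
  "carried_sites l d B = B \<union> (\<Union>v\<in>{v \<in> V d. block l v \<subseteq> B}. region l d v)"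

text \<open>\<open>y\<close> is the restriction to \<open>B\<close> of the field on \<open>S\<close>, irrespective of the boundary condition
  and of \<open>S\<close>. Taking \<open>S = carried_sites l d B\<close> shows that \<open>y\<close> depends on \<open>u\<close> only through its restriction to
  \<open>carried_sites l d B\<close>.\<close>

definition determined ::
  "'a set \<Rightarrow> (int \<Rightarrow> real \<Rightarrow> 'a \<Rightarrow> 'a \<Rightarrow> 'a) \<Rightarrow> int \<Rightarrow> int \<Rightarrow> site set \<Rightarrow> (site \<Rightarrow> real) \<Rightarrow> (site \<Rightarrow> 'a) \<Rightarrow> bool" where
  "determined E s l d B u y \<longleftrightarrow>
     (\<forall>S x. finite S \<longrightarrow> carried_sites l d B \<subseteq> S \<longrightarrow> x \<in> outer_bdry S \<rightarrow>\<^sub>E E \<longrightarrow>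
        restrict (field s l d S x u) B = y)"

definition \<Upsilon> ::
  "'a set \<Rightarrow> (int \<Rightarrow> real \<Rightarrow> 'a \<Rightarrow> 'a \<Rightarrow> 'a) \<Rightarrow> int \<Rightarrow> int \<Rightarrow> site set \<Rightarrow> (site \<Rightarrow> real) \<Rightarrow> site \<Rightarrow> 'a" where
  "\<Upsilon> E s l d B u = (THE y. determined E s l d B u y)"

end

theory Submission
  imports Defs
begin

text \<open>All fields are driven by the same uniform variables. Following a block \<open>v\<close> with \<open>W\<^sub>v = 1\<close> to its
  \<open>d\<close> graph parents, and stopping at blocks with \<open>W\<^sub>v = 0\<close>, one sees that the field at a site is the
  same for every domain containing the regions of the blocks reached by open paths, and for every
  boundary condition. Vertices on different levels of the graph have disjoint regions, so an open path of length
  \<open>n\<close> has probability \<open>(1 - \<delta>)\<^sup>n\<close>, and since there are at most \<open>d\<^sup>n\<close> of them the expected number of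
  blocks reached from a given one is at most \<open>1 / (1 - d (1 - \<delta>)) < \<infinity>\<close>. Hence the field on growing domains is eventually
  constant at each site and defines a limit field \<open>Y\<close>, to which the law on any domain is close in
  total variation, uniformly in the boundary condition. The coupling functions depend on
  the diagonal, so \<open>Y\<close> is not visibly stationary; but on finite domains the law is
  determined by \<open>K\<close> alone, hence is translation invariant, and this passes to the limit.\<close>

section \<open>The recursively constructed field\<close>

text \<open>A block is the top diagonal of its region, and W = 0 fixes the values on the block only;
  the other sites of the region still depend on the blocks of the graph parents. A single site is
  therefore first traced through a whole region, whatever the value of W there, and the exploration
  starts at the graph parents. A value fixed by W = 0 is a function of the variables on the whole
  region, which may reach beyond \<open>D\<close>; hence the comparison of domains requires them to
  contain regions, not only blocks. The hypothesis on \<delta> says exactly that d (1 - \<delta>) <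
  1. Agreement is proved for arbitrary pairs of finite domains, because squares, their shifts,
  rectangles with a receding boundary and the domains in \<open>determined\<close> all have to be
  compared with one another. The claim on \<Lambda> concerns every equilibrium law, so uniqueness is
  part of the proof: any two limit laws are compared through the same distant window.\<close>

declare field.simps [simp del]

lemma field_outside: "t \<notin> S \<Longrightarrow> field s l d S x u t = x t"
  by (cases t) (simp add: field.simps)

lemma field_inside:
  "finite S \<Longrightarrow> (i, j) \<in> S \<Longrightarrow> field s l d S x u (i, j) =
     s ((i + j - l - 1) mod ((d - 1) * l)) (u (i, j))
       (field s l d S x u (i - 1, j)) (field s l d S x u (i, j - 1))"
  by (simp add: field.simps)

text \<open>Integer coordinates have no lower bound, so well-foundedness comes from the finiteness
  of \<open>S\<close>: passing to a parent drops at least \<open>t\<close> itself from the sites of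
  \<open>S\<close> on or below its diagonal.\<close>

lemma site_sum_induct [consumes 2, case_names site]:
  assumes "finite (S :: site set)" and "t \<in> S"
    and "\<And>i j. (i, j) \<in> S \<Longrightarrow> ((i - 1, j) \<in> S \<Longrightarrow> Q (i - 1, j)) \<Longrightarrow> ((i, j - 1) \<in> S \<Longrightarrow> Q (i, j - 1))
      \<Longrightarrow> Q (i, j)"
  shows "Q t"
  using \<open>t \<in> S\<close>
proof (induction "card {r \<in> S. fst r + snd r \<le> fst t + snd t}" arbitrary: t rule: less_induct)
  case less
  obtain i j where t: "t = (i, j)" by fastforce
  have "card {r \<in> S. fst r + snd r \<le> i + j - 1} < card {r \<in> S. fst r + snd r \<le> fst t + snd t}"
    using less.prems t assms(1) by (intro psubset_card_mono psubsetI) (auto simp: set_eq_iff)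
  then show ?case
    using assms(3)[of i j] less t by (auto simp: algebra_simps)
qed

lemma mem_outer_bdry: "t \<in> S \<Longrightarrow> p \<in> parents t \<Longrightarrow> p \<notin> S \<Longrightarrow> p \<in> outer_bdry S"
  by (auto simp: outer_bdry_def)

lemma field_cong:
  assumes "finite S" "t \<in> S"
    and "\<And>r. r \<in> outer_bdry S \<Longrightarrow> x r = x' r" "\<And>r. r \<in> S \<Longrightarrow> u r = u' r"
  shows "field s l d S x u t = field s l d S x' u' t"
  using assms(1,2)
proof (induction t rule: site_sum_induct)
  case (site i j)
  have "field s l d S x u r = field s l d S x' u' r" if "r \<in> parents (i, j)" for r
    using site assms(3) mem_outer_bdry[OF site(1) that] that
    by (cases "r \<in> S") (auto simp: field_outside)
  then show ?case
    using site(1) assms(1,4) by (simp add: field_inside)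
qed

text \<open>Markov property: the recursion can be restarted on a subdomain, with the values already
  computed around it as boundary condition.\<close>

lemma field_subset:
  assumes "finite S" "R \<subseteq> S" "t \<in> R"
  shows "field s l d S x u t = field s l d R (field s l d S x u) u t"
  using finite_subset[OF assms(2,1)] assms(3)
proof (induction t rule: site_sum_induct)
  case (site i j)
  have "field s l d S x u r = field s l d R (field s l d S x u) u r" if "r \<in> parents (i, j)" for r
    using site that by (cases "r \<in> R") (auto simp: field_outside)
  then show ?case
    using site(1) assms finite_subset[OF assms(2,1)]
    by (auto simp add: field_inside subset_iff)
qed

text \<open>The recursion only moves to the left and downwards. This later allows a domain to be
  enlarged to the upper right without changing a window.\<close>

lemma field_local:
  assumes "finite S" "finite S'"
    and "\<And>r. fst r \<le> fst t \<Longrightarrow> snd r \<le> snd t \<Longrightarrow> r \<in> S \<longleftrightarrow> r \<in> S'"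
  shows "field s l d S x u t = field s l d S' x u t"
proof (cases "t \<in> S")
  case True
  with assms(1) have "(\<And>r. fst r \<le> fst t \<Longrightarrow> snd r \<le> snd t \<Longrightarrow> r \<in> S \<longleftrightarrow> r \<in> S') \<Longrightarrow> ?thesis"
  proof (induction t rule: site_sum_induct)
    case (site i j)
    have "field s l d S x u r = field s l d S' x u r" if "r \<in> parents (i, j)" for r
    proof -
      have "r \<in> S \<longleftrightarrow> r \<in> S'" using that site.prems[of r] by auto
      moreover have "field s l d S x u r = field s l d S' x u r" if "r \<in> S"
        using that \<open>r \<in> parents (i, j)\<close> site by auto
      ultimately show ?thesis by (cases "r \<in> S") (auto simp: field_outside)
    qed
    moreover have "(i, j) \<in> S'" using site.prems[of "(i, j)"] site(1) by auto
    ultimately show ?case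
      using site(1) assms(1,2) by (simp add: field_inside)
  qed
  then show ?thesis using assms(3) by blast
next
  case False
  then show ?thesis using assms(3)[of t] by (simp add: field_outside)
qed

lemma field_in_E:
  assumes s: "coupling_functions E K l d s" and l: "l \<ge> 1" and d: "d \<ge> 2"
    and S: "finite S" "t \<in> S" and x: "\<And>r. r \<in> outer_bdry S \<Longrightarrow> x r \<in> E"
    and u: "\<And>r. r \<in> S \<Longrightarrow> u r \<in> {0<..<1}"
  shows "field s l d S x u t \<in> E"
  using S
proof (induction t rule: site_sum_induct)
  case (site i j)
  have *: "field s l d S x u r \<in> E" if "r \<in> parents (i, j)" for r
    using site x mem_outer_bdry[OF site(1) that] that
    by (cases "r \<in> S") (auto simp: field_outside)
  define m where "m = (i + j - l - 1) mod ((d - 1) * l)"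
  have "(d - 1) * l > 0" using l d by simp
  then have "m \<in> {0..(d - 1) * l}"
    by (auto simp: m_def intro: order.strict_implies_order)
  \<comment> \<open>The name \<open>u'\<close> keeps the driving configuration apart from the bound
    real variable \<open>u\<close>. Measurability in the uniform variable alone already puts the
    values in \<open>E\<close>.\<close>
  then have "(\<lambda>u. s m u (field s l d S x u' (i - 1, j)) (field s l d S x u' (i, j - 1)))
      \<in> unif01 \<rightarrow>\<^sub>M state_space E" if "u' = u" for u'
    using s * that unfolding coupling_functions_def by simp
  from measurable_space[OF this[OF refl], of "u (i, j)"] u[OF site(1)]
  have "s m (u (i, j)) (field s l d S x u (i - 1, j)) (field s l d S x u (i, j - 1)) \<in> E"
    by (simp add: unif01_def space_restrict_space)
  then show ?case
    using site(1) S by (simp add: field_inside m_def)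
qed

text \<open>A site that is nobody's parent can be appended last; its variable then enters only
  through its own coupling function. This is what permits integrating out one site at a
  time.\<close>

lemma field_insert:
  assumes "finite S" "t \<notin> S" "\<And>r. r \<in> S \<Longrightarrow> t \<notin> parents r"
  shows "field s l d (insert t S) x (u(t := y)) =
    (field s l d S x u)(t := s ((fst t + snd t - l - 1) mod ((d - 1) * l)) y
       (field s l d S x u (fst t - 1, snd t)) (field s l d S x u (fst t, snd t - 1)))"
proof -
  have *: "field s l d (insert t S) x (u(t := y)) r = field s l d S x u r" if "r \<noteq> t" for r
  proof (cases "r \<in> S")
    case True
    with assms(1) show ?thesis
    proof (induction r rule: site_sum_induct)
      case (site i j)
      have "field s l d (insert t S) x (u(t := y)) r = field s l d S x u r" if "r \<in> parents (i, j)" for r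
        using site that assms(3)[OF site(1)]
        by (cases "r \<in> S") (auto simp: field_outside simp del: fun_upd_apply)
      moreover have "(i, j) \<noteq> t" using site(1) assms by auto
      ultimately show ?case
        using site(1) assms(1) by (simp add: field_inside del: fun_upd_apply) simp
    qed
  next
    case False
    then show ?thesis using that by (simp add: field_outside)
  qed
  obtain i j where t: "t = (i, j)" by fastforce
  show ?thesis
  proof
    fix r
    show "field s l d (insert t S) x (u(t := y)) r =
    ((field s l d S x u)(t := s ((fst t + snd t - l - 1) mod ((d - 1) * l)) y
       (field s l d S x u (fst t - 1, snd t)) (field s l d S x u (fst t, snd t - 1)))) r"
      using *[of r] *[of "(i - 1, j)"] *[of "(i, j - 1)"] assms(1)
      by (cases "r = t") (simp_all add: t field_inside)
  qed
qed

section \<open>Geometry of blocks and regions\<close>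

lemma V_diff: "d \<ge> 2 \<Longrightarrow> v \<in> V d \<Longrightarrow> v' \<in> V d \<Longrightarrow> fst v + snd v < fst v' + snd v'
  \<Longrightarrow> fst v + snd v + (d - 1) \<le> fst v' + snd v'"
proof -
  assume a: "d \<ge> 2" "v \<in> V d" "v' \<in> V d" "fst v + snd v < fst v' + snd v'"
  then have "(d - 1) dvd (fst v' + snd v') - (fst v + snd v)"
    by (intro dvd_diff) (auto simp: V_def)
  from zdvd_imp_le[OF this] a(4) show ?thesis by simp
qed

lemma finite_region: "finite (region l d v)"
proof -
  obtain h k where v: "v = (h, k)" by fastforce
  define a where "a = (h + k - d + 2) * l + 2"
  have "region l d v \<subseteq> {a - l * (k + 1)..l * (h + 1)} \<times> {a - l * (h + 1)..l * (k + 1)}"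
    by (auto simp: v a_def)
  then show ?thesis by (rule finite_subset) simp
qed

text \<open>In coordinates, a block occupies \<open>l\<close> consecutive columns of one
  antidiagonal, and the antidiagonal depends on h + k only.\<close>

lemma mem_block: "(i, j) \<in> block l (h, k) \<longleftrightarrow> h * l < i \<and> i \<le> (h + 1) * l \<and> i + j = (h + k + 1) * l + 1"
proof
  assume "(i, j) \<in> block l (h, k)"
  then show "h * l < i \<and> i \<le> (h + 1) * l \<and> i + j = (h + k + 1) * l + 1"
    by (auto simp: block_def offset_def algebra_simps)
next
  assume "h * l < i \<and> i \<le> (h + 1) * l \<and> i + j = (h + k + 1) * l + 1"
  then have "(i, j) = (i - h * l, l + 1 - (i - h * l)) + offset l (h, k)" "1 \<le> i - h * l" "i - h * l \<le> l"
    by (auto simp: offset_def algebra_simps)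
  then show "(i, j) \<in> block l (h, k)"
    unfolding block_def by blast
qed

lemma finite_block: "finite (block l v)"
  and card_block_le: "l \<ge> 0 \<Longrightarrow> card (block l v) \<le> nat l"
proof -
  have *: "block l v = (\<lambda>i. (i, l + 1 - i) + offset l v) ` {1..l}"
    unfolding block_def by (auto simp: image_iff)
  show "finite (block l v)" unfolding * by simp
  show "card (block l v) \<le> nat l"
    unfolding * using card_image_le[of "{1..l}" "\<lambda>i. (i, l + 1 - i) + offset l v"] by simp
qed

text \<open>The corner serves as a marked site of the block: corners of different blocks differ, so
  counting blocks reduces to counting sites.\<close>

lemma corner_block: "l \<ge> 1 \<Longrightarrow> (l, 1) + offset l v \<in> block l v"
  by (cases v) (auto simp: mem_block offset_def algebra_simps)

lemma inj_corner: "l \<ge> 1 \<Longrightarrow> inj (\<lambda>v. (l, 1) + offset l v)"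
  by (auto simp: inj_on_def offset_def)

lemma block_subset_region: "l \<ge> 1 \<Longrightarrow> d \<ge> 2 \<Longrightarrow> block l v \<subseteq> region l d v"
proof
  fix t assume ld: "l \<ge> 1" "d \<ge> 2" and "t \<in> block l v"
  obtain h k where v: "v = (h, k)" by fastforce
  obtain i j where t: "t = (i, j)" by fastforce
  have *: "h * l < i" "i \<le> (h + 1) * l" "i + j = (h + k + 1) * l + 1"
    using \<open>t \<in> block l v\<close> by (auto simp: v t mem_block)
  have "d * l \<ge> 2 * l" using ld by (intro mult_right_mono) auto
  moreover have "(h + k - d + 2) * l = (h + k + 1) * l + l - d * l"
    by (simp add: algebra_simps)
  ultimately have "(h + k - d + 2) * l + 2 \<le> i + j"
    using * ld by linarith
  moreover have "j \<le> (k + 1) * l"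
    using * ld by (simp add: algebra_simps)
  ultimately show "t \<in> region l d v"
    using * by (simp add: v t mult.commute)
qed

lemma region_offset: "t \<in> region l d (0, 0) \<Longrightarrow> t + offset l v \<in> region l d v"
  by (cases t; cases v) (auto simp: offset_def algebra_simps)

lemma block_translate: "t \<in> block l v \<Longrightarrow> \<exists>r\<in>block l (0, 0). t = r + offset l v"
  by (auto simp: block_def offset_def)

text \<open>A region lies in a band of (d - 1) l diagonals, and different levels of
  \<open>V d\<close> are at least d - 1 apart, so the bands do not overlap.\<close>

lemma region_disjoint:
  assumes "l \<ge> 1" "d \<ge> 2" "v \<in> V d" "v' \<in> V d" "fst v + snd v < fst v' + snd v'"
  shows "region l d v \<inter> region l d v' = {}"
proof -
  obtain h k where v: "v = (h, k)" by fastforce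
  obtain h' k' where v': "v' = (h', k')" by fastforce
  have "h + k + (d - 1) \<le> h' + k'"
    using V_diff[OF assms(2-5)] by (simp add: v v')
  then have "(h + k + (d - 1)) * l \<le> (h' + k') * l"
    using assms(1) by (intro mult_right_mono) auto
  then show ?thesis by (auto simp: v v' algebra_simps)
qed

lemma graph_parents_sum: "w \<in> graph_parents d v \<Longrightarrow> fst w + snd w = fst v + snd v - (d - 1)"
  by (cases v) auto

lemma graph_parents_V: "v \<in> V d \<Longrightarrow> w \<in> graph_parents d v \<Longrightarrow> w \<in> V d"
  using graph_parents_sum[of w d v] by (auto simp: V_def)

lemma graph_parents_image: "graph_parents d (h, k) = (\<lambda>i. (h - i, k + i - d + 1)) ` {0..d - 1}"
  by auto

lemma finite_graph_parents: "finite (graph_parents d v)"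
  by (cases v) (simp only: graph_parents_image, simp)

lemma card_graph_parents: "card (graph_parents d v) \<le> nat d"
proof -
  obtain h k where v: "v = (h, k)" by fastforce
  show ?thesis
    unfolding v graph_parents_image
    using card_image_le[of "{0..d - 1}" "\<lambda>i. (h - i, k + i - d + 1)"] by simp
qed

lemma outer_bdry_region:
  assumes "l \<ge> 1" "d \<ge> 2"
  shows "outer_bdry (region l d v) \<subseteq> (\<Union>w\<in>graph_parents d v. block l w)"
proof
  fix p assume p: "p \<in> outer_bdry (region l d v)"
  obtain h k where v: "v = (h, k)" by fastforce
  obtain a b where pab: "p = (a, b)" by fastforce
  from p obtain i j where ij: "(i, j) \<in> region l d v" "p \<in> parents (i, j)" "p \<notin> region l d v"
    by (auto simp: outer_bdry_def)
  \<comment> \<open>\<open>g\<close> is the first coordinate of the block sought. Since its columns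
    run from \<open>g * l + 1\<close> to \<open>(g + 1) * l\<close>, the division is applied to
    \<open>a - 1\<close>.\<close>
  define g where "g = (a - 1) div l"
  have g: "g * l < a" "a \<le> (g + 1) * l"
  proof -
    have "a - 1 = g * l + (a - 1) mod l" by (simp add: g_def)
    moreover have "0 \<le> (a - 1) mod l" "(a - 1) mod l < l" using assms by simp_all
    ultimately show "g * l < a" "a \<le> (g + 1) * l" by (auto simp: algebra_simps)
  qed
  \<comment> \<open>A parent keeps the upper bounds on both coordinates, so it can leave the region
    only by dropping one diagonal below the lowest one.\<close>
  have ab: "a + b = (h + k - d + 2) * l + 1" "a \<le> l * (h + 1)" "b \<le> l * (k + 1)"
    using ij by (auto simp: v pab)
  have "g * l < (h + 1) * l" using g ab by (simp add: mult.commute)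
  then have gh: "g \<le> h" using assms by simp
  \<comment> \<open>On this diagonal the upper bound on \<open>b\<close> is a lower bound on
    \<open>a\<close>.\<close>
  have "(h - d + 1) * l < a" using ab by (simp add: algebra_simps)
  then have "(h - d + 1) * l < (g + 1) * l" using g by linarith
  then have "h - d + 1 \<le> g" using assms by simp
  then have "(g, h + k - d + 1 - g) \<in> graph_parents d v"
    using gh by (auto simp: v intro!: exI[of _ "h - g"])
  moreover have "p \<in> block l (g, h + k - d + 1 - g)"
    using g ab by (simp add: mem_block pab)
  ultimately show "p \<in> (\<Union>w\<in>graph_parents d v. block l w)" by blast
qed

lemma ex_region:
  assumes "l \<ge> 1" "d \<ge> 2"
  shows "\<exists>v\<in>V d. t \<in> region l d v"
proof -
  obtain i j where t: "t = (i, j)" by fastforce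
  \<comment> \<open>Bands of \<open>M\<close> diagonals tile the lattice and \<open>q\<close>
    numbers the band of \<open>t\<close>. The column fixes \<open>h\<close>, and \<open>k\<close> is
    then forced by the level h + k = (d - 1)(q + 1).\<close>
  define M where "M = (d - 1) * l"
  define q where "q = (i + j - l - 2) div M"
  define h where "h = (i - 1) div l"
  define k where "k = (d - 1) * (q + 1) - h"
  have "M > 0" using assms by (simp add: M_def)
  have q: "q * M \<le> i + j - l - 2" "i + j - l - 2 < (q + 1) * M"
  proof -
    have "i + j - l - 2 = q * M + (i + j - l - 2) mod M" by (simp add: q_def)
    moreover have "0 \<le> (i + j - l - 2) mod M" "(i + j - l - 2) mod M < M" using \<open>M > 0\<close> by simp_all
    ultimately show "q * M \<le> i + j - l - 2" "i + j - l - 2 < (q + 1) * M" by (auto simp: algebra_simps)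
  qed
  have h: "h * l < i" "i \<le> (h + 1) * l"
  proof -
    have "i - 1 = h * l + (i - 1) mod l" by (simp add: h_def)
    moreover have "0 \<le> (i - 1) mod l" "(i - 1) mod l < l" using assms by simp_all
    ultimately show "h * l < i" "i \<le> (h + 1) * l" by (auto simp: algebra_simps)
  qed
  have "(h, k) \<in> V d" by (simp add: V_def k_def)
  moreover have "(h + k) * l = (q + 1) * M" by (simp add: k_def M_def algebra_simps)
  then have "(i, j) \<in> region l d (h, k)"
    using q h by (auto simp: M_def algebra_simps)
  ultimately show ?thesis using t by blast
qed

lemma finite_carried_sites:
  assumes l: "l \<ge> 1" and B: "finite B"
  shows "finite (carried_sites l d B)"
proof -
  have "{v \<in> V d. block l v \<subseteq> B} \<subseteq> (\<lambda>v. (l, 1) + offset l v) -` B"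
    using corner_block[OF l] by blast
  moreover have "finite ((\<lambda>v. (l, 1) + offset l v) -` B)"
    using B inj_corner[OF l] by (rule finite_vimageI)
  ultimately have "finite {v \<in> V d. block l v \<subseteq> B}"
    by (rule finite_subset)
  then show ?thesis
    using B finite_region by (simp add: carried_sites_def)
qed

text \<open>Freeing \<sigma> from \<Lambda> lets the same estimates serve the boundary blocks of
  \<Lambda> and the graph parents of a single vertex.\<close>

definition cluster :: "int \<Rightarrow> (site \<Rightarrow> nat) \<Rightarrow> site set \<Rightarrow> site set" where
  "cluster d w A = {v \<in> V d. \<exists>v'\<in>A. open_path d w v v'}"

lemma \<sigma>_eq_cluster: "\<sigma> l d w \<Lambda> = cluster d w {v \<in> V d. block l v \<subseteq> inner_bdry \<Lambda>}"
  by (auto simp: \<sigma>_def cluster_def)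

section \<open>Open paths\<close>

text \<open>Paths are listed backwards, from the target down to its ancestors, so that those of a
  given length form a finite set that can be counted. The starting vertex, which need not be open,
  is the last entry.\<close>

fun path_lists :: "int \<Rightarrow> nat \<Rightarrow> site \<Rightarrow> site list set" where
  "path_lists d 0 v = {[v]}"
| "path_lists d (Suc n) v = (\<Union>w\<in>graph_parents d v. (#) v ` path_lists d n w)"

lemma path_lists_finite: "finite (path_lists d n v)"
  by (induction n arbitrary: v) (auto simp: finite_graph_parents)

lemma card_path_lists: "card (path_lists d n v) \<le> nat d ^ n"
proof (induction n arbitrary: v)
  case (Suc n)
  have "card (path_lists d (Suc n) v) \<le> (\<Sum>w\<in>graph_parents d v. card ((#) v ` path_lists d n w))"
    by (simp add: card_UN_le finite_graph_parents)
  also have "\<dots> \<le> (\<Sum>w\<in>graph_parents d v. nat d ^ n)"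
    by (intro sum_mono order.trans[OF card_image_le[OF path_lists_finite] Suc.IH])
  also have "\<dots> \<le> nat d * nat d ^ n"
    using card_graph_parents[of d v] by (simp add: mult_right_mono)
  finally show ?case by simp
qed simp

lemma path_lists_nonempty: "p \<in> path_lists d n v \<Longrightarrow> p \<noteq> []"
  by (cases n) auto

lemma path_lists_length: "p \<in> path_lists d n v \<Longrightarrow> length p = Suc n"
  by (induction n arbitrary: v p) auto

lemma path_lists_V: "p \<in> path_lists d n v \<Longrightarrow> v \<in> V d \<Longrightarrow> set p \<subseteq> V d"
proof (induction n arbitrary: v p)
  case (Suc n)
  then obtain w q where q: "p = v # q" "w \<in> graph_parents d v" "q \<in> path_lists d n w"
    by auto
  with Suc graph_parents_V[of v d w] show ?case by auto
qed simp

lemma path_lists_sum_le: "d \<ge> 2 \<Longrightarrow> p \<in> path_lists d n v \<Longrightarrow> w \<in> set p \<Longrightarrow> fst w + snd w \<le> fst v + snd v"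
proof (induction n arbitrary: v p)
  case (Suc n)
  then obtain z q where q: "p = v # q" "z \<in> graph_parents d v" "q \<in> path_lists d n z"
    by auto
  show ?case
  proof (cases "w = v")
    case False
    then have "w \<in> set q" using q Suc.prems by simp
    from Suc.IH[OF Suc.prems(1) q(3) this] show ?thesis
      using graph_parents_sum[OF q(2)] Suc.prems(1) by linarith
  qed simp
qed simp

text \<open>Each step to a graph parent lowers the level by d - 1 > 0. Hence the vertices of a path
  are distinct and their regions disjoint.\<close>

lemma path_lists_sorted:
  "d \<ge> 2 \<Longrightarrow> p \<in> path_lists d n v \<Longrightarrow> sorted_wrt (\<lambda>a b. fst b + snd b < fst a + snd a) p"
proof (induction n arbitrary: v p)
  case (Suc n)
  then obtain w q where q: "p = v # q" "w \<in> graph_parents d v" "q \<in> path_lists d n w"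
    by auto
  have "fst b + snd b < fst v + snd v" if "b \<in> set q" for b
    using path_lists_sum_le[OF Suc.prems(1) q(3) that] graph_parents_sum[OF q(2)] Suc.prems(1) by linarith
  then show ?case using Suc.IH[OF Suc.prems(1) q(3)] q(1) by simp
qed simp

lemma open_path_refl: "v \<in> V d \<Longrightarrow> open_path d w v v"
  unfolding open_path_def by (intro exI[of _ 0] exI[of _ "\<lambda>_. v"]) auto

text \<open>Prepending \<open>z\<close> turns the old starting vertex \<open>v\<close> into an inner
  one, which is why \<open>w v = 1\<close> is now required while nothing is asked of
  \<open>z\<close>.\<close>

lemma open_path_step:
  assumes "open_path d w v v'" "w v = 1" "z \<in> graph_parents d v"
  shows "open_path d w z v'"
proof -
  obtain m p where p: "p 0 = v" "p m = v'" "\<forall>k\<le>m. p k \<in> V d"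
    "\<forall>k<m. p k \<in> graph_parents d (p (Suc k))" "\<forall>k\<in>{1..m}. w (p k) = 1"
    using assms(1) unfolding open_path_def by blast
  have z: "z \<in> V d" using graph_parents_V p(1,3) assms(3) by blast
  define p' where "p' = case_nat z p"
  have "p' 0 = z" "p' (Suc m) = v'" using p by (simp_all add: p'_def)
  moreover have "\<forall>k\<le>Suc m. p' k \<in> V d" using p z by (auto simp: p'_def split: nat.split)
  moreover have "\<forall>k<Suc m. p' k \<in> graph_parents d (p' (Suc k))"
    using p assms(3) by (auto simp: p'_def split: nat.split)
  moreover have "\<forall>k\<in>{1..Suc m}. w (p' k) = 1"
  proof
    fix k assume "k \<in> {1..Suc m}"
    then obtain k' where "k = Suc k'" "k' \<le> m" by (cases k) auto
    then show "w (p' k) = 1" using p assms(2) by (cases k') (auto simp: p'_def)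
  qed
  ultimately show ?thesis unfolding open_path_def by blast
qed

lemma open_path_iff:
  assumes "v' \<in> V d"
  shows "open_path d w v v' \<longleftrightarrow>
    (\<exists>n. \<exists>p\<in>path_lists d n v'. last p = v \<and> (\<forall>z\<in>set (butlast p). w z = 1))"
proof
  assume "open_path d w v v'"
  then obtain m p where p: "p 0 = v" "p m = v'"
    "\<forall>k<m. p k \<in> graph_parents d (p (Suc k))" "\<forall>k\<in>{1..m}. w (p k) = 1"
    unfolding open_path_def by blast
  have "\<exists>q\<in>path_lists d m v'. last q = v \<and> (\<forall>z\<in>set (butlast q). w z = 1)"
    using p
  proof (induction m arbitrary: v')
    case (Suc m)
    have "\<exists>q\<in>path_lists d m (p m). last q = v \<and> (\<forall>z\<in>set (butlast q). w z = 1)"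
      by (rule Suc.IH) (use Suc.prems in auto)
    then obtain q where q: "q \<in> path_lists d m (p m)" "last q = v" "\<forall>z\<in>set (butlast q). w z = 1" by blast
    have "p m \<in> graph_parents d v'" using Suc.prems by auto
    then have "v' # q \<in> path_lists d (Suc m) v'" using q by auto
    moreover have "w v' = 1" using Suc.prems by auto
    ultimately show ?case using q path_lists_nonempty[OF q(1)] by (intro bexI[of _ "v' # q"]) auto
  qed auto
  then show "\<exists>n. \<exists>p\<in>path_lists d n v'. last p = v \<and> (\<forall>z\<in>set (butlast p). w z = 1)" by blast
next
  assume "\<exists>n. \<exists>p\<in>path_lists d n v'. last p = v \<and> (\<forall>z\<in>set (butlast p). w z = 1)"
  then obtain n q where q: "q \<in> path_lists d n v'" "last q = v" "\<forall>z\<in>set (butlast q). w z = 1" by blast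
  have "\<exists>p. p 0 = v \<and> p n = v' \<and> (\<forall>k\<le>n. p k \<in> V d) \<and>
        (\<forall>k<n. p k \<in> graph_parents d (p (Suc k))) \<and> (\<forall>k\<in>{1..n}. w (p k) = 1)"
    using q assms
  proof (induction n arbitrary: v' q)
    case 0
    then show ?case by (intro exI[of _ "\<lambda>_. v"]) auto
  next
    case (Suc n)
    then obtain z q' where q': "q = v' # q'" "z \<in> graph_parents d v'" "q' \<in> path_lists d n z" by auto
    have ne: "q' \<noteq> []" using path_lists_nonempty q'(3) by blast
    obtain p where p: "p 0 = v" "p n = z" "\<forall>k\<le>n. p k \<in> V d"
        "\<forall>k<n. p k \<in> graph_parents d (p (Suc k))" "\<forall>k\<in>{1..n}. w (p k) = 1"
      using Suc.IH[OF q'(3)] Suc.prems q' ne graph_parents_V[OF Suc.prems(4) q'(2)] by auto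
    show ?case
      using p q' Suc.prems ne by (intro exI[of _ "p(Suc n := v')"]) (auto simp: less_Suc_eq le_Suc_eq)
  qed
  then show "open_path d w v v'" unfolding open_path_def by blast
qed

lemma cluster_refl: "v \<in> A \<Longrightarrow> A \<subseteq> V d \<Longrightarrow> v \<in> cluster d w A"
  using open_path_refl[of v d w] by (auto simp: cluster_def)

lemma cluster_step: "v \<in> cluster d w A \<Longrightarrow> w v = 1 \<Longrightarrow> z \<in> graph_parents d v \<Longrightarrow> z \<in> cluster d w A"
  using open_path_step[of d w v _ z] graph_parents_V[of v d z] by (auto simp: cluster_def)

section \<open>The law of the field on a rectangle\<close>

lemma unif01_prob: "prob_space unif01"
  by standard (simp add: unif01_def space_restrict_space emeasure_restrict_space)

lemma space_unif01: "space unif01 = {0<..<1}"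
  by (simp add: unif01_def space_restrict_space)

text \<open>The recursion in the definition peels off the outermost site, whereas the induction over
  the field removes the innermost one.\<close>

lemma kernel_integral_snoc:
  "kernel_integral K (ts @ [(i, j)]) f x =
     kernel_integral K ts (\<lambda>x. \<integral>\<^sup>+ y. f (x((i, j) := y)) \<partial>K (x (i - 1, j), x (i, j - 1))) x"
  by (induction ts arbitrary: x) auto

text \<open>The kernel is the same at every site, so sites may be relabelled. All translation
  invariance below originates here.\<close>

lemma kernel_integral_shift:
  "kernel_integral K (map (\<lambda>t. t + v) ts) f x =
     kernel_integral K ts (\<lambda>y. f (\<lambda>t. y (t - v))) (\<lambda>t. x (t + v))"
proof (induction ts arbitrary: x)
  case (Cons t ts)
  obtain i j where t: "t = (i, j)" by fastforce
  obtain a b where v: "v = (a, b)" by fastforce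
  have "(x((a + i, b + j) := y)) (r + v) = ((\<lambda>t. x (t + v))((i, j) := y)) r" for y r
    by (cases r) (auto simp: v)
  then have *: "(\<lambda>r. (x((a + i, b + j) := y)) (r + v)) = (\<lambda>t. x (t + v))((i, j) := y)" for y
    by blast
  show ?case
    by (simp add: t v Cons.IH[unfolded v] *[unfolded v] algebra_simps del: fun_upd_apply)
qed (simp add: fun_eq_iff)

lemma measurable_nn_integral_kernel:
  assumes K: "transition_kernel E K"
    and f: "(\<lambda>(x, y). f x y) \<in> borel_measurable (M \<Otimes>\<^sub>M state_space E)"
    and a: "a \<in> M \<rightarrow>\<^sub>M state_space E" and b: "b \<in> M \<rightarrow>\<^sub>M state_space E"
  shows "(\<lambda>x. \<integral>\<^sup>+ y. f x y \<partial>K (a x, b x)) \<in> borel_measurable M"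
proof -
  have "(\<lambda>x. K (a x, b x)) \<in> M \<rightarrow>\<^sub>M subprob_algebra (state_space E)"
    using K a b unfolding transition_kernel_def
    by (intro measurable_prob_algebraD) (rule measurable_compose[OF measurable_Pair])
  then show ?thesis using f by (intro nn_integral_measurable_subprob_algebra2)
qed

text \<open>Points of \<open>PiM S\<close> are \<open>undefined\<close> off \<open>S\<close>, while
  functions of the field may also read boundary values; the overlay puts these back.\<close>

definition overlay :: "site set \<Rightarrow> (site \<Rightarrow> 'a) \<Rightarrow> (site \<Rightarrow> 'a) \<Rightarrow> site \<Rightarrow> 'a" where
  "overlay S x y = (\<lambda>t. if t \<in> S then y t else x t)"

text \<open>The last site is integrated out first. For fixed variables at the other sites this only involves
  \<open>u \<mapsto> s m u x y\<close>, so separate measurability of the \<open>s m\<close> suffices once the field is measurable.\<close>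

lemma nn_integral_field:
  assumes K: "transition_kernel E K" and s: "coupling_functions E K l d s"
    and l: "l \<ge> 1" and d: "d \<ge> 2"
    and meas: "\<And>S x. finite S \<Longrightarrow> x \<in> outer_bdry S \<rightarrow>\<^sub>E E \<Longrightarrow>
          (\<lambda>u. restrict (field s l d S x u) S)
            \<in> PiM S (\<lambda>_. unif01) \<rightarrow>\<^sub>M PiM S (\<lambda>_. state_space E)"
    and ts: "distinct ts" "sorted_wrt (\<lambda>a b. b \<notin> parents a) ts"
    and x: "\<And>r. r \<in> outer_bdry (set ts) \<Longrightarrow> x r \<in> E"
    and f: "(\<lambda>y. f (overlay (set ts) x y)) \<in> borel_measurable (PiM (set ts) (\<lambda>_. state_space E))"
  shows "(\<integral>\<^sup>+ u. f (field s l d (set ts) x u) \<partial>PiM (set ts) (\<lambda>_. unif01)) = kernel_integral K ts f x"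
  using ts x f
proof (induction ts arbitrary: f rule: rev_induct)
  case Nil
  interpret prob_space "PiM {} (\<lambda>_::site. unif01)"
    by (intro prob_space_PiM unif01_prob)
  have "field s l d {} x u = x" for u by (auto simp: field_outside)
  then show ?case using emeasure_space_1 by simp
next
  case (snoc t ts)
  obtain i j where t: "t = (i, j)" by fastforce
  interpret product_sigma_finite "\<lambda>_::site. unif01"
    by (intro product_sigma_finite.intro prob_space_imp_sigma_finite unif01_prob)
  let ?S = "set ts"
  let ?M = "state_space E"
  have tS: "t \<notin> ?S" and order: "\<And>r. r \<in> ?S \<Longrightarrow> t \<notin> parents r"
    using snoc.prems by (auto simp: sorted_wrt_append)
  have tp: "t \<notin> parents t" by (auto simp: t)
  \<comment> \<open>\<open>t\<close> is not a parent of earlier sites, so the boundary of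
    \<open>set ts\<close> and the outside parents of \<open>t\<close> all belong to the boundary of
    the longer list.\<close>
  have x': "x r \<in> E" if "r \<in> outer_bdry ?S \<union> (parents t - ?S)" for r
  proof -
    have "r \<in> outer_bdry (set (ts @ [t]))"
      using that order tp by (auto simp: outer_bdry_def)
    then show ?thesis using snoc.prems by blast
  qed
  have fS: "field s l d ?S x u r \<in> E"
    if "u \<in> space (PiM ?S (\<lambda>_. unif01))" "r \<in> ?S \<union> outer_bdry ?S \<union> parents t" for u r
  proof (cases "r \<in> ?S")
    case True
    then show ?thesis
      using that x' by (intro field_in_E[OF s l d]) (auto simp: space_PiM PiE_iff space_unif01)
  next
    case False
    then show ?thesis using that x' by (auto simp: field_outside)
  qed
  define m where "m = (fst t + snd t - l - 1) mod ((d - 1) * l)"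
  have "(d - 1) * l > 0" using l d by simp
  then have m: "m \<in> {0..(d - 1) * l}"
    by (auto simp: m_def intro: order.strict_implies_order)
  define g where "g X = (\<integral>\<^sup>+ y. f (X((i, j) := y)) \<partial>K (X (i - 1, j), X (i, j - 1)))" for X
  have f': "(\<lambda>y. f (overlay (insert t ?S) x y)) \<in> borel_measurable (PiM (insert t ?S) (\<lambda>_. ?M))"
    using snoc.prems by simp
  have ov: "(overlay ?S x y)(t := z) = overlay (insert t ?S) x (y(t := z))" for y z
    by (auto simp: overlay_def fun_eq_iff)
  have f2: "(\<lambda>(y, z). f ((overlay ?S x y)(t := z))) \<in> borel_measurable (PiM ?S (\<lambda>_. ?M) \<Otimes>\<^sub>M ?M)"
    unfolding ov using measurable_compose[OF measurable_add_dim f'] by (simp add: case_prod_beta')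
  have coord: "(\<lambda>y. overlay ?S x y p) \<in> PiM ?S (\<lambda>_. ?M) \<rightarrow>\<^sub>M ?M" if "p \<in> parents t" for p
  proof (cases "p \<in> ?S")
    case True
    then show ?thesis by (simp add: overlay_def)
  next
    case False
    then have "x p \<in> space ?M" using x' that by (simp add: space_restrict_space)
    then show ?thesis using False by (simp add: overlay_def)
  qed
  have g: "(\<lambda>y. g (overlay ?S x y)) \<in> borel_measurable (PiM ?S (\<lambda>_. ?M))"
    unfolding g_def
    using f2 coord by (intro measurable_nn_integral_kernel[OF K]) (auto simp: t)
  have ext: "field s l d R x u = overlay R x (restrict (field s l d R x u) R)" for R u
    by (auto simp: overlay_def fun_eq_iff field_outside)
  have meas': "(\<lambda>u. restrict (field s l d (insert t ?S) x u) (insert t ?S))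
      \<in> PiM (insert t ?S) (\<lambda>_. unif01) \<rightarrow>\<^sub>M PiM (insert t ?S) (\<lambda>_. ?M)"
  proof -
    \<comment> \<open>The measurability hypothesis speaks of extensional boundary conditions;
      cutting \<open>x\<close> down to the boundary leaves the field unchanged on the
      domain.\<close>
    have "restrict (field s l d (insert t ?S) x u) (insert t ?S) =
      restrict (field s l d (insert t ?S) (restrict x (outer_bdry (insert t ?S))) u) (insert t ?S)" for u
      by (intro restrict_ext field_cong) auto
    moreover have "restrict x (outer_bdry (insert t ?S)) \<in> outer_bdry (insert t ?S) \<rightarrow>\<^sub>E E"
      using snoc.prems(3) by auto
    ultimately show ?thesis using meas[of "insert t ?S"] by simp
  qed
  have "(\<lambda>u. f (field s l d (insert t ?S) x u)) \<in> borel_measurable (PiM (insert t ?S) (\<lambda>_. unif01))"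
    by (subst ext) (rule measurable_compose[OF meas' f'])
  then have "(\<integral>\<^sup>+ u. f (field s l d (set (ts @ [t])) x u) \<partial>PiM (set (ts @ [t])) (\<lambda>_. unif01)) =
     (\<integral>\<^sup>+ u. (\<integral>\<^sup>+ y. f (field s l d (insert t ?S) x (u(t := y))) \<partial>unif01) \<partial>PiM ?S (\<lambda>_. unif01))"
    using product_nn_integral_insert[OF _ tS] by simp
  also have "\<dots> = (\<integral>\<^sup>+ u. g (field s l d ?S x u) \<partial>PiM ?S (\<lambda>_. unif01))"
  proof (intro nn_integral_cong)
    fix u assume u: "u \<in> space (PiM ?S (\<lambda>_. unif01))"
    let ?X = "field s l d ?S x u"
    have E: "?X (i - 1, j) \<in> E" "?X (i, j - 1) \<in> E"
      using fS[OF u] by (auto simp: t)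
    have sm: "(\<lambda>y. s m y (?X (i - 1, j)) (?X (i, j - 1))) \<in> unif01 \<rightarrow>\<^sub>M ?M"
      "distr unif01 ?M (\<lambda>y. s m y (?X (i - 1, j)) (?X (i, j - 1))) = K (?X (i - 1, j), ?X (i, j - 1))"
      using s m E unfolding coupling_functions_def by auto
    have "restrict ?X ?S \<in> space (PiM ?S (\<lambda>_. ?M))"
      using fS[OF u] by (auto simp: space_PiM space_restrict_space)
    then have "(\<lambda>z. f ((overlay ?S x (restrict ?X ?S))(t := z))) \<in> borel_measurable ?M"
      using measurable_compose[OF measurable_Pair1' f2] by simp
    then have fz: "(\<lambda>z. f (?X(t := z))) \<in> borel_measurable ?M"
      by (simp add: ext[symmetric])
    have "(\<integral>\<^sup>+ y. f (field s l d (insert t ?S) x (u(t := y))) \<partial>unif01) =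
       (\<integral>\<^sup>+ y. f (?X(t := s m y (?X (i - 1, j)) (?X (i, j - 1)))) \<partial>unif01)"
      by (simp only: field_insert[of ?S t, OF _ tS order] finite_set) (simp add: m_def t)
    also have "\<dots> = (\<integral>\<^sup>+ z. f (?X(t := z)) \<partial>distr unif01 ?M (\<lambda>y. s m y (?X (i - 1, j)) (?X (i, j - 1))))"
      using fz sm(1) by (subst nn_integral_distr) simp_all
    also have "\<dots> = g ?X" by (simp add: sm(2) g_def t)
    finally show "(\<integral>\<^sup>+ y. f (field s l d (insert t ?S) x (u(t := y))) \<partial>unif01) = g ?X" .
  qed
  also have "\<dots> = kernel_integral K ts g x"
    using snoc.prems x' g by (intro snoc.IH) (auto simp: sorted_wrt_append)
  also have "\<dots> = kernel_integral K (ts @ [t]) f x"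
    unfolding t kernel_integral_snoc g_def ..
  finally show ?case .
qed

section \<open>Lexicographic enumeration of rectangles and translation of configurations\<close>

lemma set_rect_sites: "set (rect_sites m n) = rect m n"
  by (auto simp: rect_sites_def rect_def)

lemma rect_sites_lex:
  assumes "sorted_wrt (<) (is :: int list)" "sorted_wrt (<) (js :: int list)"
  shows "sorted_wrt (\<lambda>a b. fst a < fst b \<or> fst a = fst b \<and> snd a < snd b)
    (concat (map (\<lambda>i. map (Pair i) js) is))"
  using assms by (induction "is") (auto simp: sorted_wrt_append sorted_wrt_map)

lemma rect_sites_sorted:
  "sorted_wrt (\<lambda>a b. fst a < fst b \<or> fst a = fst b \<and> snd a < snd b) (rect_sites m n)"
proof -
  have *: "sorted_wrt (<) [a..b]" for a b :: int
    using strict_sorted_iff by auto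
  have "rect_sites m n = concat (map (\<lambda>i. map (Pair i) [1..n]) [1..m])"
    by (simp add: rect_sites_def)
  then show ?thesis using rect_sites_lex[OF * *] by simp
qed

text \<open>Parents precede their children lexicographically, also after a translation.\<close>

lemma rect_sites_order:
  "sorted_wrt (\<lambda>a b. b \<notin> parents a) (map (\<lambda>t. t + v) (rect_sites m n))"
  unfolding sorted_wrt_map
  by (cases v, rule sorted_wrt_mono_rel[OF _ rect_sites_sorted]) auto

lemma rect_sites_distinct: "distinct (map (\<lambda>t. t + v) (rect_sites m n))"
proof -
  have "distinct (rect_sites m n)"
    unfolding distinct_conv_nth using rect_sites_sorted[of m n]
    by (fastforce simp: sorted_wrt_iff_nth_less neq_iff)
  then show ?thesis by (simp add: distinct_map)
qed

lemma translate_measurable: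
  assumes "\<And>t. t \<in> A \<Longrightarrow> t + v \<in> S"
  shows "translate v A \<in> PiM S (\<lambda>_. M) \<rightarrow>\<^sub>M PiM A (\<lambda>_. M)"
  unfolding translate_def using assms by (intro measurable_restrict) simp

lemma translate_cong: "(\<And>t. t \<in> A \<Longrightarrow> y (t + v) = y' (t + v)) \<Longrightarrow> translate v A y = translate v A y'"
  by (auto simp: translate_def)

lemma translate_0: "translate 0 A = (\<lambda>y. restrict y A)"
  by (simp add: translate_def fun_eq_iff)

text \<open>The side condition keeps the outer map from reading sites outside \<open>B\<close>,
  where the inner configuration is \<open>undefined\<close>.\<close>

lemma translate_translate:
  assumes "\<And>t. t \<in> A \<Longrightarrow> t + v \<in> B"
  shows "translate v A (translate w B y) = translate (v + w) A y"
  using assms by (auto simp: translate_def fun_eq_iff add.assoc)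

section \<open>The coupled field and its law on translated rectangles\<close>

locale coupled_field =
  fixes E :: "'a::polish_space set"
    and K :: "'a \<times> 'a \<Rightarrow> 'a measure"
    and l d :: int
    and s :: "int \<Rightarrow> real \<Rightarrow> 'a \<Rightarrow> 'a \<Rightarrow> 'a"
    and P :: "'w measure"
    and U :: "site \<Rightarrow> 'w \<Rightarrow> real"
    and W :: "site \<Rightarrow> 'w \<Rightarrow> nat"
    and \<psi> :: "(site \<Rightarrow> real) \<Rightarrow> nat"
    and \<Phi> :: "(site \<Rightarrow> real) \<Rightarrow> site \<Rightarrow> 'a"
    and \<delta> :: real
  assumes K: "transition_kernel E K"
    and l: "l \<ge> 1" and d: "d \<ge> 2"
    and coupling: "coupling_functions E K l d s"
    and field_measurable: "\<And>S x. finite S \<Longrightarrow> x \<in> outer_bdry S \<rightarrow>\<^sub>E E \<Longrightarrow>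
          (\<lambda>u. restrict (field s l d S x u) S)
            \<in> PiM S (\<lambda>_. unif01) \<rightarrow>\<^sub>M PiM S (\<lambda>_. state_space E)"
    and P: "prob_space P"
    and U_indep: "prob_space.indep_vars P (\<lambda>_. unif01) U UNIV"
    and U_unif: "\<And>t. distr P unif01 (U t) = unif01"
    and \<psi>: "\<psi> \<in> PiM (region l d (0, 0)) (\<lambda>_. unif01) \<rightarrow>\<^sub>M count_space {0, 1}"
    and \<Phi>: "\<Phi> \<in> PiM (region l d (0, 0)) (\<lambda>_. unif01)
               \<rightarrow>\<^sub>M PiM (block l (0, 0)) (\<lambda>_. state_space E)"
    and W: "\<And>v \<omega>. v \<in> V d \<Longrightarrow> \<omega> \<in> space P \<Longrightarrow>
          W v \<omega> = \<psi> (translate (offset l v) (region l d (0, 0)) (\<lambda>t. U t \<omega>))"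
    and W_prob: "\<And>v. v \<in> V d \<Longrightarrow> measure P {\<omega> \<in> space P. W v \<omega> = 0} = \<delta>"
    and \<delta>: "\<delta> > (real_of_int d - 1) / real_of_int d"
    and W_zero: "\<And>v \<omega> x. v \<in> V d \<Longrightarrow> \<omega> \<in> space P \<Longrightarrow> W v \<omega> = 0 \<Longrightarrow>
          x \<in> outer_bdry (region l d v) \<rightarrow>\<^sub>E E \<Longrightarrow>
          translate (offset l v) (block l (0, 0)) (block_map s l d v (\<lambda>t. U t \<omega>) x)
            = \<Phi> (translate (offset l v) (region l d (0, 0)) (\<lambda>t. U t \<omega>))"
begin

sublocale prob_space P
  by (rule P)

abbreviation "M \<equiv> state_space E"
abbreviation "X S x \<omega> \<equiv> field s l d S x (\<lambda>t. U t \<omega>)"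

lemma U_measurable [measurable]: "U t \<in> P \<rightarrow>\<^sub>M unif01"
  using U_indep unfolding indep_vars_def by blast

lemma U_range: "\<omega> \<in> space P \<Longrightarrow> U t \<omega> \<in> {0<..<1}"
  using measurable_space[OF U_measurable] by (simp add: space_unif01)

lemma U_restrict_measurable: "(\<lambda>\<omega>. restrict (\<lambda>t. U t \<omega>) S) \<in> P \<rightarrow>\<^sub>M PiM S (\<lambda>_. unif01)"
  by (intro measurable_restrict) simp

lemma U_law:
  assumes "S \<noteq> {}"
  shows "distr P (PiM S (\<lambda>_. unif01)) (\<lambda>\<omega>. restrict (\<lambda>t. U t \<omega>) S) = PiM S (\<lambda>_. unif01)"
  using indep_vars_iff_distr_eq_PiM'[OF assms, where M' = "\<lambda>_. unif01" and X = U] indep_vars_subset[OF U_indep, of S]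
  by (simp add: U_unif)

text \<open>\<Phi> sends some configuration to a configuration on a nonempty block. Thus boundary
  conditions exist, and statements about all of them have content.\<close>

lemma E_nonempty: "E \<noteq> {}"
proof
  assume "E = {}"
  obtain \<omega> where "\<omega> \<in> space P" using not_empty by blast
  then have "restrict (\<lambda>t. U t \<omega>) (region l d (0, 0)) \<in> space (PiM (region l d (0, 0)) (\<lambda>_. unif01))"
    using measurable_space[OF U_restrict_measurable] by blast
  from measurable_space[OF \<Phi> this] have "space (PiM (block l (0, 0)) (\<lambda>_. M)) \<noteq> {}" by blast
  then show False
    using \<open>E = {}\<close> corner_block[OF l, of "(0, 0)"] by (auto simp: space_PiM PiE_eq_empty_iff space_restrict_space)
qed

lemma X_in_E:
  assumes "finite S" "t \<in> S" "\<And>r. r \<in> outer_bdry S \<Longrightarrow> x r \<in> E" "\<omega> \<in> space P"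
  shows "X S x \<omega> t \<in> E"
  using assms U_range by (intro field_in_E[OF coupling l d]) auto

lemma X_restrict_measurable:
  assumes S: "finite S" and x: "\<And>r. r \<in> outer_bdry S \<Longrightarrow> x r \<in> E"
  shows "(\<lambda>\<omega>. restrict (X S x \<omega>) S) \<in> P \<rightarrow>\<^sub>M PiM S (\<lambda>_. M)"
proof -
  have "restrict x (outer_bdry S) \<in> outer_bdry S \<rightarrow>\<^sub>E E" using x by auto
  note measurable_compose[OF U_restrict_measurable field_measurable[OF S this]]
  moreover have "restrict (field s l d S (restrict x (outer_bdry S)) (restrict (\<lambda>t. U t \<omega>) S)) S =
    restrict (X S x \<omega>) S" for \<omega>
    using S by (intro restrict_ext field_cong) auto
  ultimately show ?thesis by simp
qed

lemma X_measurable: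
  assumes S: "finite S" "t \<in> S" and x: "\<And>r. r \<in> outer_bdry S \<Longrightarrow> x r \<in> E"
  shows "(\<lambda>\<omega>. X S x \<omega> t) \<in> P \<rightarrow>\<^sub>M M"
  using measurable_compose[OF X_restrict_measurable[OF S(1) x] measurable_component_singleton[OF S(2)]] S(2)
  by simp

lemma X_translate_measurable:
  assumes S: "finite S" "\<And>t. t \<in> A \<Longrightarrow> t + v \<in> S" and x: "\<And>r. r \<in> outer_bdry S \<Longrightarrow> x r \<in> E"
  shows "(\<lambda>\<omega>. translate v A (X S x \<omega>)) \<in> P \<rightarrow>\<^sub>M PiM A (\<lambda>_. M)"
  unfolding translate_def using assms by (intro measurable_restrict X_measurable)

text \<open>The right side is built from coupling functions whose index depends on the diagonal,
  hence on \<open>v\<close>; the left side sees \<open>v\<close> only through the boundary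
  condition.\<close>

lemma unilateral_law_eq_distr:
  assumes ne: "rect m n \<noteq> {}" and S: "S = (\<lambda>t. t + v) ` rect m n"
    and x: "\<And>r. r \<in> outer_bdry S \<Longrightarrow> x r \<in> E"
  shows "unilateral_law E K (\<lambda>t. x (t + v)) m n =
    distr P (PiM (rect m n) (\<lambda>_. M)) (\<lambda>\<omega>. translate v (rect m n) (X S x \<omega>))"
proof -
  have fin: "finite S" by (simp add: S rect_def)
  have mem: "t \<in> rect m n \<Longrightarrow> t + v \<in> S" for t by (auto simp: S)
  have Sne: "S \<noteq> {}" using ne by (simp add: S)
  define ts where "ts = map (\<lambda>t. t + v) (rect_sites m n)"
  have ts: "set ts = S" "distinct ts" "sorted_wrt (\<lambda>a b. b \<notin> parents a) ts"
    using rect_sites_distinct rect_sites_order by (simp_all only: ts_def set_map set_rect_sites S)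
  have "kernel_integral K (rect_sites m n) (\<lambda>y. indicator A (restrict y (rect m n))) (\<lambda>t. x (t + v)) =
      emeasure P ((\<lambda>\<omega>. translate v (rect m n) (X S x \<omega>)) -` A \<inter> space P)"
    if A: "A \<in> sets (PiM (rect m n) (\<lambda>_. M))" for A
  proof -
    define f :: "(site \<Rightarrow> 'a) \<Rightarrow> ennreal" where "f y = indicator A (translate v (rect m n) y)" for y
    have ov: "translate v (rect m n) (overlay S x y) = translate v (rect m n) y" for y
      using mem by (intro translate_cong) (simp add: overlay_def)
    have fov: "f (overlay S x y) = f y" for y
      by (simp add: f_def ov)
    have fm: "f \<in> borel_measurable (PiM S (\<lambda>_. M))"
      unfolding f_def using A translate_measurable[of "rect m n" v S M, OF mem] by simp
    have fr: "f y = f (restrict y S)" for y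
      unfolding f_def using mem by (intro arg_cong[of _ _ "indicator A"] translate_cong) simp
    have "restrict x (outer_bdry S) \<in> outer_bdry S \<rightarrow>\<^sub>E E" using x by auto
    from field_measurable[OF fin this]
    have "(\<lambda>u. restrict (field s l d S x u) S) \<in> PiM S (\<lambda>_. unif01) \<rightarrow>\<^sub>M PiM S (\<lambda>_. M)"
      using field_cong[OF fin, of _ "restrict x (outer_bdry S)" x] by (simp cong: restrict_cong)
    then have fX: "(\<lambda>u. f (field s l d S x u)) \<in> borel_measurable (PiM S (\<lambda>_. unif01))"
      by (subst fr) (rule measurable_compose[OF _ fm])
    have "kernel_integral K (rect_sites m n) (\<lambda>y. indicator A (restrict y (rect m n))) (\<lambda>t. x (t + v)) =
       kernel_integral K ts f x"
      unfolding ts_def kernel_integral_shift f_def translate_def restrict_def by (simp cong: if_cong)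
    also have "\<dots> = (\<integral>\<^sup>+ u. f (field s l d S x u) \<partial>PiM S (\<lambda>_. unif01))"
      using nn_integral_field[OF K coupling l d field_measurable ts(2,3), of x f] x fm
      by (simp add: ts fov)
    also have "\<dots> = (\<integral>\<^sup>+ u. f (field s l d S x u)
        \<partial>distr P (PiM S (\<lambda>_. unif01)) (\<lambda>\<omega>. restrict (\<lambda>t. U t \<omega>) S))"
      by (simp add: U_law[OF Sne])
    also have "\<dots> = (\<integral>\<^sup>+ \<omega>. f (field s l d S x (restrict (\<lambda>t. U t \<omega>) S)) \<partial>P)"
      using fX by (intro nn_integral_distr U_restrict_measurable) simp
    also have "\<dots> = (\<integral>\<^sup>+ \<omega>. f (X S x \<omega>) \<partial>P)"
      unfolding f_def using mem fin
      by (intro nn_integral_cong arg_cong[of _ _ "indicator A"] translate_cong field_cong) auto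
    also have "\<dots> = (\<integral>\<^sup>+ \<omega>. indicator ((\<lambda>\<omega>. translate v (rect m n) (X S x \<omega>)) -` A \<inter> space P) \<omega> \<partial>P)"
      unfolding f_def by (intro nn_integral_cong) (simp add: indicator_def)
    also have "\<dots> = emeasure P ((\<lambda>\<omega>. translate v (rect m n) (X S x \<omega>)) -` A \<inter> space P)"
      using measurable_sets[OF X_translate_measurable[OF fin mem x] A] by simp
    finally show ?thesis .
  qed
  \<comment> \<open>Both sides are \<open>measure_of\<close> the same sigma-algebra, so equal set
    functions suffice; countable additivity of the iterated integral need not be shown
    separately.\<close>
  then show ?thesis
    unfolding unilateral_law_def distr_def
    by (intro measure_of_eq sets.space_closed) (simp add: sets.sigma_sets_eq)
qed

end

section \<open>Coalescence\<close>

context coupled_field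
begin

abbreviation "Cl A \<omega> \<equiv> cluster d (\<lambda>v. W v \<omega>) A"

lemma U_translate_space:
  "\<omega> \<in> space P \<Longrightarrow> translate (offset l v) (region l d (0, 0)) (\<lambda>t. U t \<omega>) \<in> space (PiM (region l d (0, 0)) (\<lambda>_. unif01))"
  using U_range by (auto simp: translate_def space_PiM space_unif01)

lemma W_binary: "v \<in> V d \<Longrightarrow> \<omega> \<in> space P \<Longrightarrow> W v \<omega> = 0 \<or> W v \<omega> = 1"
  using measurable_space[OF \<psi> U_translate_space] by (simp add: W)

lemma X_outer_region:
  assumes "finite S" "region l d v \<subseteq> S" "\<And>r. r \<in> outer_bdry S \<Longrightarrow> x r \<in> E" "\<omega> \<in> space P"
    and r: "r \<in> outer_bdry (region l d v)"
  shows "X S x \<omega> r \<in> E"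
proof (cases "r \<in> S")
  case False
  then have "r \<in> outer_bdry S"
    using r assms(2) by (auto simp: outer_bdry_def)
  then show ?thesis using False assms(3) by (simp add: field_outside)
qed (use assms X_in_E in blast)

text \<open>The right side mentions neither \<open>S\<close> nor \<open>x\<close>: whatever values
  the field on \<open>S\<close> takes around the region, they form an admissible boundary condition
  for it.\<close>

lemma X_zero_block:
  assumes v: "v \<in> V d" and \<omega>: "\<omega> \<in> space P" and W0: "W v \<omega> = 0"
    and S: "finite S" "region l d v \<subseteq> S" and x: "\<And>r. r \<in> outer_bdry S \<Longrightarrow> x r \<in> E"
    and t: "t \<in> block l v"
  shows "X S x \<omega> t = \<Phi> (translate (offset l v) (region l d (0, 0)) (\<lambda>t. U t \<omega>)) (t - offset l v)"
proof -
  let ?y = "restrict (X S x \<omega>) (outer_bdry (region l d v))"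
  obtain r where r: "r \<in> block l (0, 0)" "t = r + offset l v"
    using block_translate[OF t] by blast
  have tr: "t \<in> region l d v" using t block_subset_region[OF l d] by blast
  have "?y \<in> outer_bdry (region l d v) \<rightarrow>\<^sub>E E"
    using X_outer_region[OF S x \<omega>] by auto
  from fun_cong[OF W_zero[OF v \<omega> W0 this], of r]
  have "field s l d (region l d v) ?y (\<lambda>t. U t \<omega>) t =
      \<Phi> (translate (offset l v) (region l d (0, 0)) (\<lambda>t. U t \<omega>)) (t - offset l v)"
    using r t by (simp add: translate_def block_map_def)
  moreover have "X S x \<omega> t = field s l d (region l d v) ?y (\<lambda>t. U t \<omega>) t"
    unfolding field_subset[OF S tr] using tr by (intro field_cong finite_region) auto
  ultimately show ?thesis by simp
qed

text \<open>The blocks of the graph parents cover the outer boundary of the region, so agreement on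
  them passes to all of it.\<close>

lemma X_region_eq:
  assumes S: "finite S" "finite S'" "region l d v \<subseteq> S" "region l d v \<subseteq> S'"
    and eq: "\<And>w r. w \<in> graph_parents d v \<Longrightarrow> r \<in> block l w \<Longrightarrow> X S x \<omega> r = X S' x' \<omega> r"
    and t: "t \<in> region l d v"
  shows "X S x \<omega> t = X S' x' \<omega> t"
proof -
  have "field s l d (region l d v) (X S x \<omega>) (\<lambda>t. U t \<omega>) t = field s l d (region l d v) (X S' x' \<omega>) (\<lambda>t. U t \<omega>) t"
    using t eq outer_bdry_region[OF l d, of v] by (intro field_cong finite_region) auto
  then show ?thesis
    using field_subset[OF S(1,3) t, of s l d x "\<lambda>t. U t \<omega>"] field_subset[OF S(2,4) t, of s l d x' "\<lambda>t. U t \<omega>"]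
    by simp
qed

text \<open>At a closed vertex both fields equal \<Phi>; at an open one the parents are again in the
  cluster. The descent stops because all regions met lie in the finite set \<open>S\<close>.\<close>

lemma X_cluster_eq:
  assumes \<omega>: "\<omega> \<in> space P" and A: "A \<subseteq> V d"
    and S: "finite S" "finite S'" "\<And>v. v \<in> Cl A \<omega> \<Longrightarrow> region l d v \<subseteq> S \<inter> S'"
    and x: "\<And>r. r \<in> outer_bdry S \<Longrightarrow> x r \<in> E" and x': "\<And>r. r \<in> outer_bdry S' \<Longrightarrow> x' r \<in> E"
    and v: "v \<in> Cl A \<omega>" and t: "t \<in> block l v"
  shows "X S x \<omega> t = X S' x' \<omega> t"
proof -
  \<comment> \<open>A lower bound for the diagonals of \<open>S\<close>, the floor of the
    descent.\<close>
  obtain L where L: "\<And>r. r \<in> S \<Longrightarrow> L \<le> fst r + snd r"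
  proof (cases "S = {}")
    case False
    then show ?thesis using that[of "Min ((\<lambda>r. fst r + snd r) ` S)"] S(1) by simp
  qed (use that in blast)
  have low: "L \<le> (fst v + snd v + 1) * l + 1" if "v \<in> Cl A \<omega>" for v
  proof -
    obtain h k where v: "v = (h, k)" by fastforce
    have "(l, 1) + offset l v \<in> S"
      using S(3)[OF that] corner_block[OF l, of v] block_subset_region[OF l d, of v] by blast
    from L[OF this] show ?thesis by (simp add: v offset_def algebra_simps)
  qed
  show ?thesis
    using v t
  \<comment> \<open>By \<open>low\<close> this number is positive at every cluster vertex, so
    truncation by \<open>nat\<close> cannot spoil its strict decrease.\<close>
  proof (induction "nat ((fst v + snd v + 1) * l + 2 - L)" arbitrary: v t rule: less_induct)
    case less
    have vV: "v \<in> V d" using less.prems(1) by (simp add: cluster_def)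
    note SS = S(3)[OF less.prems(1)]
    from W_binary[OF vV \<omega>] show ?case
    proof
      assume "W v \<omega> = 0"
      then show ?thesis
        using X_zero_block[OF vV \<omega> _ S(1)] X_zero_block[OF vV \<omega> _ S(2)] SS x x' less.prems(2) by auto
    next
      assume W1: "W v \<omega> = 1"
      have par: "X S x \<omega> r = X S' x' \<omega> r" if w: "w \<in> graph_parents d v" "r \<in> block l w" for w r
      proof (rule less.hyps)
        show w': "w \<in> Cl A \<omega>" using cluster_step[OF less.prems(1) W1 w(1)] .
        have "fst w + snd w < fst v + snd v" using graph_parents_sum[OF w(1)] d by linarith
        then have "(fst w + snd w + 1) * l < (fst v + snd v + 1) * l" using l by simp
        then show "nat ((fst w + snd w + 1) * l + 2 - L) < nat ((fst v + snd v + 1) * l + 2 - L)"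
          using low[OF w'] by linarith
      qed (rule w(2))
      have sub: "region l d v \<subseteq> S" "region l d v \<subseteq> S'" using SS by simp_all
      have "t \<in> region l d v" using less.prems(2) block_subset_region[OF l d] by blast
      with S(1,2) sub par show ?thesis by (rule X_region_eq)
    qed
  qed
qed

text \<open>Several regions may contain \<open>t\<close>; any of them will do.\<close>

definition vert :: "site \<Rightarrow> site" where
  "vert t = (SOME v. v \<in> V d \<and> t \<in> region l d v)"

lemma vert: "vert t \<in> V d" "t \<in> region l d (vert t)"
  using someI_ex[of "\<lambda>v. v \<in> V d \<and> t \<in> region l d v"] ex_region[OF l d, of t]
  unfolding vert_def by blast+

text \<open>The region of \<open>vert t\<close> is always included and its parents always explored:
  W = 0 at \<open>vert t\<close> would say nothing about \<open>t\<close> unless \<open>t\<close> is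
  in the block.\<close>

definition influence :: "site \<Rightarrow> 'w \<Rightarrow> site set" where
  "influence t \<omega> = region l d (vert t) \<union> (\<Union>v\<in>Cl (graph_parents d (vert t)) \<omega>. region l d v)"

lemma graph_parents_vert: "graph_parents d (vert t) \<subseteq> V d"
  using graph_parents_V vert by blast

lemma X_influence_eq:
  assumes \<omega>: "\<omega> \<in> space P" and S: "finite S" "finite S'" "influence t \<omega> \<subseteq> S" "influence t \<omega> \<subseteq> S'"
    and x: "\<And>r. r \<in> outer_bdry S \<Longrightarrow> x r \<in> E" and x': "\<And>r. r \<in> outer_bdry S' \<Longrightarrow> x' r \<in> E"
  shows "X S x \<omega> t = X S' x' \<omega> t"
proof (rule X_region_eq[OF S(1,2) _ _ _ vert(2)])
  show "region l d (vert t) \<subseteq> S" "region l d (vert t) \<subseteq> S'"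
    using S by (auto simp: influence_def)
  fix w r assume w: "w \<in> graph_parents d (vert t)" "r \<in> block l w"
  show "X S x \<omega> r = X S' x' \<omega> r"
    using S by (intro X_cluster_eq[OF \<omega> graph_parents_vert S(1,2) _ x x' cluster_refl[OF w(1) graph_parents_vert] w(2)])
      (auto simp: influence_def)
qed

text \<open>Agreement on the cluster blocks covers the inner boundary of \<Lambda>; from there it
  spreads inwards, since every other site of \<Lambda> has both parents in \<Lambda>.\<close>

lemma X_D_eq:
  assumes \<omega>: "\<omega> \<in> space P" and \<Lambda>: "finite \<Lambda>" "union_of_blocks l d (inner_bdry \<Lambda>)"
    and S: "finite S" "finite S'" "carried_sites l d (D l d (\<lambda>v. W v \<omega>) \<Lambda>) \<subseteq> S \<inter> S'"
    and x: "\<And>r. r \<in> outer_bdry S \<Longrightarrow> x r \<in> E" and x': "\<And>r. r \<in> outer_bdry S' \<Longrightarrow> x' r \<in> E"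
    and t: "t \<in> D l d (\<lambda>v. W v \<omega>) \<Lambda>"
  shows "X S x \<omega> t = X S' x' \<omega> t"
proof -
  define A where "A = {v \<in> V d. block l v \<subseteq> inner_bdry \<Lambda>}"
  have D_eq: "D l d (\<lambda>v. W v \<omega>) \<Lambda> = \<Lambda> \<union> (\<Union>v\<in>Cl A \<omega>. block l v)"
    by (simp add: D_def \<sigma>_eq_cluster A_def)
  have AV: "A \<subseteq> V d" by (auto simp: A_def)
  have "region l d v \<subseteq> S \<inter> S'" if "v \<in> Cl A \<omega>" for v
  proof -
    have "v \<in> V d" "block l v \<subseteq> D l d (\<lambda>v. W v \<omega>) \<Lambda>"
      using that by (auto simp: D_eq cluster_def)
    then have "region l d v \<subseteq> carried_sites l d (D l d (\<lambda>v. W v \<omega>) \<Lambda>)"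
      unfolding carried_sites_def by blast
    then show ?thesis using S(3) by blast
  qed
  then have blocks: "X S x \<omega> r = X S' x' \<omega> r" if "v \<in> Cl A \<omega>" "r \<in> block l v" for v r
    using that by (intro X_cluster_eq[OF \<omega> AV S(1,2) _ x x']) auto
  have sub: "\<Lambda> \<subseteq> S" "\<Lambda> \<subseteq> S'" using S(3) by (auto simp: carried_sites_def D_eq)
  show ?thesis
  proof (cases "t \<in> \<Lambda>")
    case True
    with \<Lambda>(1) show ?thesis
    proof (induction t rule: site_sum_induct)
      case (site i j)
      show ?case
      proof (cases "(i, j) \<in> inner_bdry \<Lambda>")
        case True
        then obtain v where "v \<in> A" "(i, j) \<in> block l v"
          using \<Lambda>(2) by (fastforce simp: union_of_blocks_def A_def)
        then show ?thesis using blocks cluster_refl AV by blast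
      next
        case False
        then have "(i - 1, j) \<in> \<Lambda>" "(i, j - 1) \<in> \<Lambda>"
          using site(1) by (auto simp: inner_bdry_def outer_bdry_def)
        then show ?thesis
          using site sub S(1,2) by (auto simp: field_inside subset_iff)
      qed
    qed
  next
    case False
    then obtain v where "v \<in> Cl A \<omega>" "t \<in> block l v" using t by (auto simp: D_eq)
    then show ?thesis by (rule blocks)
  qed
qed

lemma ex_boundary: "\<exists>x. x \<in> outer_bdry S \<rightarrow>\<^sub>E E"
  using E_nonempty by (metis PiE_eq_empty_iff ex_in_conv)

text \<open>Uniqueness of the described configuration needs one admissible domain and boundary
  condition: the carried sites are finite as soon as \<open>D\<close> is, and \<open>E\<close> is
  nonempty.\<close>

lemma determined_\<Upsilon>:
  assumes \<omega>: "\<omega> \<in> space P" and \<Lambda>: "finite \<Lambda>" "union_of_blocks l d (inner_bdry \<Lambda>)"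
    and fin: "finite (D l d (\<lambda>v. W v \<omega>) \<Lambda>)"
  shows "determined E s l d (D l d (\<lambda>v. W v \<omega>) \<Lambda>) (\<lambda>t. U t \<omega>) (\<Upsilon> E s l d (D l d (\<lambda>v. W v \<omega>) \<Lambda>) (\<lambda>t. U t \<omega>))"
    (is "determined E s l d ?B ?u _")
proof -
  let ?S = "carried_sites l d ?B"
  have S: "finite ?S" using finite_carried_sites[OF l fin] .
  obtain x where x: "x \<in> outer_bdry ?S \<rightarrow>\<^sub>E E" using ex_boundary by blast
  have "determined E s l d ?B ?u (restrict (field s l d ?S x ?u) ?B)"
    unfolding determined_def using x S
    by (intro allI impI restrict_ext X_D_eq[OF \<omega> \<Lambda>]) auto
  moreover have "y = restrict (field s l d ?S x ?u) ?B" if "determined E s l d ?B ?u y" for y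
    using that x S unfolding determined_def by blast
  ultimately show ?thesis unfolding \<Upsilon>_def by (rule theI)
qed

end

section \<open>The expected number of open paths\<close>

context coupled_field
begin

text \<open>The ratio of the geometric series: at most d ^ n paths of length n, each open with
  probability (1 - \<delta>) ^ n.\<close>

definition \<theta> :: real where "\<theta> = real_of_int d * (1 - \<delta>)"

lemma V0: "(0, 0) \<in> V d"
  by (simp add: V_def)

lemma \<delta>_le_1: "\<delta> \<le> 1"
  using W_prob[OF V0] prob_le_1 by metis

lemma \<theta>: "0 \<le> \<theta>" "\<theta> < 1"
proof -
  show "0 \<le> \<theta>" using \<delta>_le_1 d by (simp add: \<theta>_def)
  have "real_of_int d - 1 < \<delta> * real_of_int d"
    using \<delta> d by (simp add: divide_less_eq)
  then show "\<theta> < 1" by (simp add: \<theta>_def algebra_simps)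
qed

text \<open>The event W = 1 as a set in the coordinates of the region, the form in which
  independence over disjoint regions applies.\<close>

definition W_set :: "site \<Rightarrow> (site \<Rightarrow> real) set" where
  "W_set v = {u \<in> space (PiM (region l d v) (\<lambda>_. unif01)). \<psi> (translate (offset l v) (region l d (0, 0)) u) = 1}"

lemma W_set_sets: "W_set v \<in> sets (PiM (region l d v) (\<lambda>_. unif01))"
proof -
  have "(\<lambda>u. \<psi> (translate (offset l v) (region l d (0, 0)) u)) \<in> PiM (region l d v) (\<lambda>_. unif01) \<rightarrow>\<^sub>M count_space {0, 1}"
    by (rule measurable_compose[OF translate_measurable \<psi>]) (rule region_offset)
  from measurable_sets[OF this, of "{1}"] show ?thesis
    by (auto simp: W_set_def vimage_def Int_def conj_commute)
qed

lemma W_event_eq: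
  assumes "v \<in> V d"
  shows "{\<omega> \<in> space P. W v \<omega> = 1} = (\<lambda>\<omega>. restrict (\<lambda>t. U t \<omega>) (region l d v)) -` W_set v \<inter> space P"
proof -
  have "translate (offset l v) (region l d (0, 0)) (restrict (\<lambda>t. U t \<omega>) (region l d v)) =
      translate (offset l v) (region l d (0, 0)) (\<lambda>t. U t \<omega>)" for \<omega>
    by (intro translate_cong) (simp add: region_offset)
  then show ?thesis
    using measurable_space[OF U_restrict_measurable[of "region l d v"]] W[OF assms] by (auto simp: W_set_def)
qed

lemma W_event [measurable]: "v \<in> V d \<Longrightarrow> {\<omega> \<in> space P. W v \<omega> = 1} \<in> events"
  unfolding W_event_eq using U_restrict_measurable W_set_sets by (rule measurable_sets)

lemma prob_W1: "v \<in> V d \<Longrightarrow> prob {\<omega> \<in> space P. W v \<omega> = 1} = 1 - \<delta>"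
proof -
  assume v: "v \<in> V d"
  have "{\<omega> \<in> space P. W v \<omega> = 0} = space P - {\<omega> \<in> space P. W v \<omega> = 1}"
    using W_binary[OF v] by auto
  then have "\<delta> = 1 - prob {\<omega> \<in> space P. W v \<omega> = 1}"
    using W_prob[OF v] prob_compl[OF W_event[OF v]] by simp
  then show ?thesis by simp
qed

text \<open>Vertices on pairwise different levels have disjoint regions, so their \<open>W\<close>
  are functions of disjoint families of independent variables.\<close>

lemma prob_open:
  assumes L: "finite L" "L \<subseteq> V d" and sums: "inj_on (\<lambda>v. fst v + snd v) L"
  shows "prob {\<omega> \<in> space P. \<forall>v\<in>L. W v \<omega> = 1} = (1 - \<delta>) ^ card L"
proof (cases "L = {}")
  case True
  then show ?thesis by (simp add: prob_space)
next
  case False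
  have "disjoint_family_on (region l d) L"
    unfolding disjoint_family_on_def
  proof (intro ballI impI)
    fix v w assume vw: "v \<in> L" "w \<in> L" "v \<noteq> w"
    then have "fst v + snd v \<noteq> fst w + snd w" using sums by (auto simp: inj_on_def)
    then show "region l d v \<inter> region l d w = {}"
      using region_disjoint[OF l d, of v w] region_disjoint[OF l d, of w v] vw L(2) by (auto simp: neq_iff)
  qed
  then have "indep_vars (\<lambda>v. PiM (region l d v) (\<lambda>_. unif01)) (\<lambda>v \<omega>. restrict (\<lambda>t. U t \<omega>) (region l d v)) L"
    by (intro indep_vars_restrict[OF U_indep]) auto
  from indep_varsD_finite[OF this False L(1), of W_set] W_set_sets
  have "prob (\<Inter>v\<in>L. (\<lambda>\<omega>. restrict (\<lambda>t. U t \<omega>) (region l d v)) -` W_set v \<inter> space P) =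
     (\<Prod>v\<in>L. prob ((\<lambda>\<omega>. restrict (\<lambda>t. U t \<omega>) (region l d v)) -` W_set v \<inter> space P))" by blast
  also have "(\<Prod>v\<in>L. prob ((\<lambda>\<omega>. restrict (\<lambda>t. U t \<omega>) (region l d v)) -` W_set v \<inter> space P)) = (\<Prod>v\<in>L. 1 - \<delta>)"
  proof (intro prod.cong refl)
    fix v assume "v \<in> L"
    then have "v \<in> V d" using L(2) by blast
    then show "prob ((\<lambda>\<omega>. restrict (\<lambda>t. U t \<omega>) (region l d v)) -` W_set v \<inter> space P) = 1 - \<delta>"
      using W_event_eq[of v] prob_W1[of v] by simp
  qed
  also have "(\<Inter>v\<in>L. (\<lambda>\<omega>. restrict (\<lambda>t. U t \<omega>) (region l d v)) -` W_set v \<inter> space P) =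
      (\<Inter>v\<in>L. {\<omega> \<in> space P. W v \<omega> = 1})"
  proof (intro INF_cong refl)
    fix v assume "v \<in> L"
    then have "v \<in> V d" using L(2) by blast
    then show "(\<lambda>\<omega>. restrict (\<lambda>t. U t \<omega>) (region l d v)) -` W_set v \<inter> space P = {\<omega> \<in> space P. W v \<omega> = 1}"
      using W_event_eq[of v] by simp
  qed
  also have "\<dots> = {\<omega> \<in> space P. \<forall>v\<in>L. W v \<omega> = 1}"
    using False by auto
  finally show ?thesis by simp
qed

definition open_list :: "site list \<Rightarrow> 'w set" where
  "open_list p = {\<omega> \<in> space P. \<forall>v\<in>set (butlast p). W v \<omega> = 1}"

lemma open_list_event:
  assumes "p \<in> path_lists d n v" "v \<in> V d"
  shows "open_list p \<in> events"
proof -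
  have "{\<omega> \<in> space P. \<forall>v\<in>set (butlast p). W v \<omega> = 1} =
      space P \<inter> (\<Inter>v\<in>set (butlast p). {\<omega> \<in> space P. W v \<omega> = 1})"
    by auto
  moreover have "\<dots> \<in> events"
  proof (cases "set (butlast p) = {}")
    case False
    then show ?thesis
      using path_lists_V[OF assms] by (intro sets.Int sets.top sets.finite_INT W_event) (auto dest: in_set_butlastD)
  qed simp
  ultimately show ?thesis by (simp add: open_list_def)
qed

text \<open>The exponent is n although the list has n + 1 entries, because the last one carries no
  condition.\<close>

lemma prob_open_list:
  assumes "p \<in> path_lists d n v" "v \<in> V d"
  shows "prob (open_list p) = (1 - \<delta>) ^ n"
proof -
  have "butlast p @ [last p] = p"
    using path_lists_nonempty[OF assms(1)] by simp
  then have sorted: "sorted_wrt (\<lambda>a b. fst b + snd b < fst a + snd a) (butlast p)"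
    using path_lists_sorted[OF d assms(1)] by (metis sorted_wrt_append)
  have ne: "fst (butlast p ! i) + snd (butlast p ! i) \<noteq> fst (butlast p ! j) + snd (butlast p ! j)"
    if "i < length (butlast p)" "j < length (butlast p)" "i \<noteq> j" for i j
    using sorted that unfolding sorted_wrt_iff_nth_less by (metis less_irrefl linorder_neqE_nat)
  have "distinct (butlast p)"
    unfolding distinct_conv_nth using ne by metis
  then have "card (set (butlast p)) = n"
    using path_lists_length[OF assms(1)] by (simp add: distinct_card)
  moreover have "inj_on (\<lambda>v. fst v + snd v) (set (butlast p))"
  proof (rule inj_onI)
    fix x y assume xy: "x \<in> set (butlast p)" "y \<in> set (butlast p)" "fst x + snd x = fst y + snd y"
    then obtain i j where "i < length (butlast p)" "j < length (butlast p)" "x = butlast p ! i" "y = butlast p ! j"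
      unfolding in_set_conv_nth by blast
    with xy(3) ne[of i j] show "x = y" by blast
  qed
  ultimately show ?thesis
    using prob_open[of "set (butlast p)"] path_lists_V[OF assms]
    by (auto simp: open_list_def dest: in_set_butlastD)
qed

lemma mem_cluster_iff:
  assumes "A \<subseteq> V d" "\<omega> \<in> space P"
  shows "v \<in> Cl A \<omega> \<longleftrightarrow> (\<exists>v'\<in>A. \<exists>n. \<exists>p\<in>path_lists d n v'. last p = v \<and> \<omega> \<in> open_list p)"
proof -
  have *: "open_path d (\<lambda>v. W v \<omega>) v v' \<longleftrightarrow> (\<exists>n. \<exists>p\<in>path_lists d n v'. last p = v \<and> \<omega> \<in> open_list p)"
    if "v' \<in> A" for v'
    using open_path_iff[of v' d "\<lambda>v. W v \<omega>" v] that assms by (auto simp: open_list_def)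
  have "v \<in> V d" if "v' \<in> A" "p \<in> path_lists d n v'" "last p = v" for p n v'
    using path_lists_V[OF that(2)] path_lists_nonempty[OF that(2)] that assms(1) last_in_set[of p] by blast
  then have "v \<in> Cl A \<omega> \<longleftrightarrow> (\<exists>v'\<in>A. open_path d (\<lambda>v. W v \<omega>) v v')"
    unfolding cluster_def mem_Collect_eq using * by metis
  then show ?thesis using * by blast
qed

lemma cluster_event:
  assumes "A \<subseteq> V d"
  shows "{\<omega> \<in> space P. v \<in> Cl A \<omega>} \<in> events"
proof -
  have sub: "open_list p \<subseteq> space P" for p by (auto simp: open_list_def)
  have "{\<omega> \<in> space P. v \<in> Cl A \<omega>} =
     (\<Union>v'\<in>A. \<Union>n. \<Union>p\<in>{p \<in> path_lists d n v'. last p = v}. open_list p)" (is "_ = ?R")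
  proof (intro set_eqI iffI)
    fix \<omega> assume "\<omega> \<in> {\<omega> \<in> space P. v \<in> Cl A \<omega>}"
    then show "\<omega> \<in> ?R"
      using mem_cluster_iff[OF assms, of \<omega> v] by blast
  next
    fix \<omega> assume R: "\<omega> \<in> ?R"
    then have "\<omega> \<in> space P" using sub by blast
    then show "\<omega> \<in> {\<omega> \<in> space P. v \<in> Cl A \<omega>}"
      using mem_cluster_iff[OF assms, of \<omega> v] R by blast
  qed
  moreover have "?R \<in> events"
  proof (intro sets.countable_UN'' sets.finite_UN)
    fix v' n p assume "v' \<in> A" "p \<in> {p \<in> path_lists d n v'. last p = v}"
    then show "open_list p \<in> events" using open_list_event[of p n v'] assms by blast
  qed (simp_all add: path_lists_finite)
  ultimately show ?thesis by simp
qed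

lemma cluster_eq_paths:
  assumes "A \<subseteq> V d" "\<omega> \<in> space P"
  shows "Cl A \<omega> = (\<Union>v'\<in>A. \<Union>n. \<Union>p\<in>path_lists d n v'. if \<omega> \<in> open_list p then {last p} else {})"
proof (rule set_eqI)
  fix v
  have "(v \<in> (if \<omega> \<in> open_list p then {last p} else {})) \<longleftrightarrow> last p = v \<and> \<omega> \<in> open_list p" for p by auto
  then show "v \<in> Cl A \<omega> \<longleftrightarrow>
      v \<in> (\<Union>v'\<in>A. \<Union>n. \<Union>p\<in>path_lists d n v'. if \<omega> \<in> open_list p then {last p} else {})"
    unfolding mem_cluster_iff[OF assms] UN_iff by simp
qed

text \<open>Paths are counted instead of vertices: a sum of indicators is measurable with an
  explicit expectation, and it dominates the cluster size, each vertex being counted once per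
  path.\<close>

definition path_count :: "site set \<Rightarrow> 'w \<Rightarrow> ennreal" where
  "path_count A \<omega> = (\<Sum>v'\<in>A. \<Sum>n. \<Sum>p\<in>path_lists d n v'. indicator (open_list p) \<omega>)"

lemma path_count_measurable:
  assumes "A \<subseteq> V d"
  shows "path_count A \<in> borel_measurable P"
  unfolding path_count_def using assms
  by (intro borel_measurable_sum borel_measurable_suminf_order borel_measurable_indicator open_list_event) auto

text \<open>Counting measure replaces \<open>card\<close>, which would give an infinite cluster the
  size 0.\<close>

lemma cluster_le_path_count:
  assumes A: "A \<subseteq> V d" "finite A" and \<omega>: "\<omega> \<in> space P"
  shows "emeasure (count_space UNIV) (Cl A \<omega>) \<le> path_count A \<omega>"
proof -
  let ?c = "emeasure (count_space (UNIV :: site set))"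
  let ?S = "\<lambda>p. if \<omega> \<in> open_list p then {last p :: site} else {}"
  have "?c (Cl A \<omega>) \<le> (\<Sum>v'\<in>A. ?c (\<Union>n. \<Union>p\<in>path_lists d n v'. ?S p))"
    unfolding cluster_eq_paths[OF A(1) \<omega>] using A by (intro emeasure_subadditive_finite) auto
  also have "\<dots> \<le> (\<Sum>v'\<in>A. \<Sum>n. ?c (\<Union>p\<in>path_lists d n v'. ?S p))"
    by (intro sum_mono emeasure_subadditive_countably) auto
  also have "\<dots> \<le> (\<Sum>v'\<in>A. \<Sum>n. \<Sum>p\<in>path_lists d n v'. ?c (?S p))"
    by (intro sum_mono suminf_le emeasure_subadditive_finite path_lists_finite) auto
  also have "\<dots> = path_count A \<omega>"
    unfolding path_count_def by (intro sum.cong suminf_cong refl) (auto simp: indicator_def)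
  finally show ?thesis .
qed

lemma nn_integral_path_count:
  assumes A: "A \<subseteq> V d"
  shows "(\<integral>\<^sup>+ \<omega>. path_count A \<omega> \<partial>P) \<le> ennreal (real (card A) / (1 - \<theta>))"
proof -
  have "(\<integral>\<^sup>+ \<omega>. path_count A \<omega> \<partial>P) = (\<Sum>v'\<in>A. \<Sum>n. \<Sum>p\<in>path_lists d n v'. emeasure P (open_list p))"
    unfolding path_count_def using A
    by (subst nn_integral_sum nn_integral_suminf,
        (intro borel_measurable_sum borel_measurable_suminf_order borel_measurable_indicator open_list_event; force),
        intro sum.cong suminf_cong refl)+
       (auto intro!: nn_integral_indicator open_list_event)
  also have "\<dots> \<le> (\<Sum>v'\<in>A. \<Sum>n. ennreal (\<theta> ^ n))"
  proof (intro sum_mono suminf_le)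
    fix v' n assume "v' \<in> A"
    then have "v' \<in> V d" using A by blast
    have "(\<Sum>p\<in>path_lists d n v'. emeasure P (open_list p)) = (\<Sum>p\<in>path_lists d n v'. ennreal ((1 - \<delta>) ^ n))"
      using \<open>v' \<in> V d\<close> by (intro sum.cong refl) (simp add: emeasure_eq_measure prob_open_list)
    also have "\<dots> = ennreal (real (card (path_lists d n v')) * (1 - \<delta>) ^ n)"
      using \<delta>_le_1 by (simp add: ennreal_mult ennreal_of_nat_eq_real_of_nat)
    also have "\<dots> \<le> ennreal (real (nat d ^ n) * (1 - \<delta>) ^ n)"
      using \<delta>_le_1 card_path_lists[of d n v'] by (intro ennreal_leI mult_right_mono) (simp_all only: of_nat_le_iff, simp)
    also have "\<dots> = ennreal (\<theta> ^ n)"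
      using d by (simp add: \<theta>_def power_mult_distrib)
    finally show "(\<Sum>p\<in>path_lists d n v'. emeasure P (open_list p)) \<le> ennreal (\<theta> ^ n)" .
  qed auto
  also have "\<dots> = (\<Sum>v'\<in>A. ennreal (1 / (1 - \<theta>)))"
    using \<theta> suminf_geometric[of \<theta>] summable_geometric[of \<theta>] by (subst suminf_ennreal2) auto
  also have "\<dots> = ennreal (real (card A) / (1 - \<theta>))"
    using \<theta> by (simp add: ennreal_of_nat_eq_real_of_nat ennreal_mult[symmetric])
  finally show ?thesis .
qed

lemma AE_finite_cluster:
  assumes A: "A \<subseteq> V d" "finite A"
  shows "AE \<omega> in P. finite (Cl A \<omega>)"
proof -
  have "(\<integral>\<^sup>+ \<omega>. path_count A \<omega> \<partial>P) \<noteq> \<infinity>"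
    using nn_integral_path_count[OF A(1)] by (auto simp: top_unique)
  from nn_integral_PInf_AE[OF path_count_measurable[OF A(1)] this] AE_space show ?thesis
  proof eventually_elim
    case (elim \<omega>)
    then have "emeasure (count_space UNIV) (Cl A \<omega>) \<noteq> \<infinity>"
      using cluster_le_path_count[OF A, of \<omega>] by (auto simp: top_unique)
    then show ?case by (auto simp: emeasure_count_space split: if_splits)
  qed
qed

end

section \<open>The limit field\<close>

definition square :: "nat \<Rightarrow> site set" where
  "square N = {- int N..int N} \<times> {- int N..int N}"

lemma finite_square: "finite (square N)"
  by (simp add: square_def)

lemma square_mono: "N \<le> N' \<Longrightarrow> square N \<subseteq> square N'"
  by (auto simp: square_def)

lemma finite_subset_square:
  assumes "finite A"
  shows "\<exists>N. A \<subseteq> square N"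
  using assms
proof induction
  case (insert t A)
  then obtain N where N: "A \<subseteq> square N" by blast
  define N' where "N' = max N (nat (max \<bar>fst t\<bar> \<bar>snd t\<bar>))"
  have "t \<in> square N'" by (cases t) (auto simp: square_def N'_def)
  moreover have "A \<subseteq> square N'" using N square_mono[of N N'] by (auto simp: N'_def)
  ultimately show ?case by blast
qed simp

context coupled_field
begin

text \<open>A constant boundary condition, hence unchanged by every shift of the lattice.\<close>

definition x0 :: "site \<Rightarrow> 'a" where
  "x0 = (\<lambda>_. SOME e. e \<in> E)"

lemma x0: "x0 t \<in> E"
  unfolding x0_def using E_nonempty by (simp add: some_in_eq)

lemma influence_event: "{\<omega> \<in> space P. influence t \<omega> \<subseteq> S} \<in> events"
proof (cases "region l d (vert t) \<subseteq> S")
  case True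
  then have "{\<omega> \<in> space P. influence t \<omega> \<subseteq> S} =
      space P - (\<Union>v\<in>{v. \<not> region l d v \<subseteq> S}. {\<omega> \<in> space P. v \<in> Cl (graph_parents d (vert t)) \<omega>})"
    unfolding influence_def by blast
  also have "\<dots> \<in> events"
    using cluster_event[OF graph_parents_vert] by (intro sets.Diff sets.top sets.countable_UN'') auto
  finally show ?thesis .
next
  case False
  then have "{\<omega> \<in> space P. influence t \<omega> \<subseteq> S} = {}"
    unfolding influence_def by blast
  then show ?thesis by (simp only: sets.empty_sets)
qed

lemma AE_finite_influence: "AE \<omega> in P. finite (influence t \<omega>)"
  using AE_finite_cluster[OF graph_parents_vert[of t] finite_graph_parents]
  by eventually_elim (simp add: influence_def finite_region)

text \<open>If the influence set is infinite no square contains it and the value is arbitrary; this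
  happens only on a null set.\<close>

definition depth :: "site \<Rightarrow> 'w \<Rightarrow> nat" where
  "depth t \<omega> = (LEAST N. influence t \<omega> \<subseteq> square N)"

definition Y :: "site \<Rightarrow> 'w \<Rightarrow> 'a" where
  "Y t \<omega> = X (square (depth t \<omega>)) x0 \<omega> t"

lemma X_x0_measurable: "finite S \<Longrightarrow> (\<lambda>\<omega>. X S x0 \<omega> t) \<in> P \<rightarrow>\<^sub>M M"
  using X_measurable[of S t x0] x0 by (cases "t \<in> S") (simp_all add: field_outside space_restrict_space)

text \<open>\<open>Y\<close> selects one of countably many measurable fields by a measurable index,
  so it is measurable on all of \<open>P\<close>, including the null set.\<close>

lemma Y_measurable [measurable]: "Y t \<in> P \<rightarrow>\<^sub>M M"
proof -
  have "depth t \<in> P \<rightarrow>\<^sub>M count_space UNIV"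
    unfolding depth_def using influence_event by (intro measurable_Least) (simp add: pred_def)
  then have "(\<lambda>\<omega>. X (square (depth t \<omega>)) x0 \<omega> t) \<in> P \<rightarrow>\<^sub>M M"
    by (rule measurable_compose_countable[rotated]) (rule X_x0_measurable[OF finite_square])
  then show ?thesis unfolding Y_def[abs_def] .
qed

lemma Y_eq:
  assumes \<omega>: "\<omega> \<in> space P" and S: "finite S" "influence t \<omega> \<subseteq> S"
    and x: "\<And>r. r \<in> outer_bdry S \<Longrightarrow> x r \<in> E"
  shows "X S x \<omega> t = Y t \<omega>"
proof -
  obtain N where "influence t \<omega> \<subseteq> square N"
    using finite_subset_square finite_subset[OF S(2,1)] by blast
  then have "influence t \<omega> \<subseteq> square (depth t \<omega>)"
    unfolding depth_def by (rule LeastI)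
  then show ?thesis
    unfolding Y_def using S x x0 finite_square by (intro X_influence_eq[OF \<omega>]) auto
qed

lemma Y_translate_measurable: "(\<lambda>\<omega>. translate v J (\<lambda>t. Y t \<omega>)) \<in> P \<rightarrow>\<^sub>M PiM J (\<lambda>_. M)"
  unfolding translate_def by (intro measurable_restrict Y_measurable)

text \<open>The fields differ on \<open>J\<close> only off the event that all influence sets lie in
  \<open>square N\<close>. As this event knows nothing of the domain and the boundary condition,
  \<open>N\<close> works for all of them: the source of uniform convergence.\<close>

lemma X_law_close:
  assumes J: "finite J" and \<epsilon>: "0 < \<epsilon>"
  shows "\<exists>N. \<forall>S x. finite S \<longrightarrow> square N \<subseteq> S \<longrightarrow> (\<forall>r\<in>outer_bdry S. x r \<in> E) \<longrightarrow> (\<forall>t\<in>J. t + v \<in> S) \<longrightarrow>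
    (\<forall>A\<in>sets (PiM J (\<lambda>_. M)).
      \<bar>measure (distr P (PiM J (\<lambda>_. M)) (\<lambda>\<omega>. translate v J (X S x \<omega>))) A -
       measure (distr P (PiM J (\<lambda>_. M)) (\<lambda>\<omega>. translate v J (\<lambda>t. Y t \<omega>))) A\<bar> \<le> \<epsilon>)"
proof -
  define G where "G N = {\<omega> \<in> space P. \<forall>t\<in>J. influence (t + v) \<omega> \<subseteq> square N}" for N
  have G_event: "G N \<in> events" for N
  proof -
    have "G N = space P - (\<Union>t\<in>J. space P - {\<omega> \<in> space P. influence (t + v) \<omega> \<subseteq> square N})"
      unfolding G_def by blast
    also have "\<dots> \<in> events"
      by (intro sets.Diff sets.top sets.finite_UN J influence_event)
    finally show ?thesis .
  qed
  have "incseq G"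
    unfolding incseq_def G_def le_fun_def using square_mono by blast
  have "AE \<omega> in P. \<forall>t\<in>J. finite (influence (t + v) \<omega>)"
    using J AE_finite_influence by (simp add: AE_ball_countable countable_finite)
  then have "AE \<omega> in P. \<omega> \<in> (\<Union>N. G N)"
    using AE_space
  proof eventually_elim
    case (elim \<omega>)
    then have "finite (\<Union>t\<in>J. influence (t + v) \<omega>)" using J by blast
    then obtain N where "(\<Union>t\<in>J. influence (t + v) \<omega>) \<subseteq> square N"
      using finite_subset_square by blast
    then show ?case using elim by (auto simp: G_def)
  qed
  then have "prob (\<Union>N. G N) = 1"
    using G_event by (subst prob_eq_1) auto
  moreover have "(\<lambda>N. prob (G N)) \<longlonglongrightarrow> prob (\<Union>N. G N)"
    using G_event \<open>incseq G\<close> by (intro finite_Lim_measure_incseq) auto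
  ultimately have "eventually (\<lambda>N. prob (G N) > 1 - \<epsilon>) sequentially"
    using \<epsilon> by (intro order_tendstoD(1)[of _ 1]) auto
  then obtain N where N: "prob (G N) > 1 - \<epsilon>"
    by (auto simp: eventually_sequentially)
  show ?thesis
  proof (intro exI[of _ N] allI impI ballI)
    fix S x A
    assume S: "finite S" "square N \<subseteq> S" and x: "\<forall>r\<in>outer_bdry S. x r \<in> E" and JS: "\<forall>t\<in>J. t + v \<in> S"
      and A: "A \<in> sets (PiM J (\<lambda>_. M))"
    let ?X = "\<lambda>\<omega>. translate v J (X S x \<omega>)" and ?Y = "\<lambda>\<omega>. translate v J (\<lambda>t. Y t \<omega>)"
    have mX: "?X \<in> P \<rightarrow>\<^sub>M PiM J (\<lambda>_. M)"
      using JS x by (intro X_translate_measurable[OF S(1)]) auto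
    have mY: "?Y \<in> P \<rightarrow>\<^sub>M PiM J (\<lambda>_. M)" by (rule Y_translate_measurable)
    define a where "a = ?X -` A \<inter> space P"
    define b where "b = ?Y -` A \<inter> space P"
    have ab: "a \<in> events" "b \<in> events"
      using measurable_sets[OF mX A] measurable_sets[OF mY A] by (auto simp: a_def b_def)
    have XY: "?X \<omega> = ?Y \<omega>" if "\<omega> \<in> G N" for \<omega>
    proof (rule translate_cong)
      fix t assume "t \<in> J"
      then have "influence (t + v) \<omega> \<subseteq> S" "\<omega> \<in> space P" using that S(2) by (auto simp: G_def)
      then show "X S x \<omega> (t + v) = Y (t + v) \<omega>" using Y_eq S(1) x by blast
    qed
    \<comment> \<open>The coupling inequality: the two events differ only off
      \<open>G N\<close>.\<close>
    have sub: "a \<subseteq> b \<union> (space P - G N)" "b \<subseteq> a \<union> (space P - G N)"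
      using XY by (auto simp: a_def b_def)
    have compl: "prob (space P - G N) < \<epsilon>" using N prob_compl[OF G_event] by simp
    have "prob a \<le> prob b + prob (space P - G N)"
      using ab G_event finite_measure_mono[OF sub(1)] measure_Un_le[of b P "space P - G N"] by force
    moreover have "prob b \<le> prob a + prob (space P - G N)"
      using ab G_event finite_measure_mono[OF sub(2)] measure_Un_le[of a P "space P - G N"] by force
    ultimately have "\<bar>prob a - prob b\<bar> \<le> \<epsilon>" using compl by linarith
    then show "\<bar>measure (distr P (PiM J (\<lambda>_. M)) ?X) A - measure (distr P (PiM J (\<lambda>_. M)) ?Y) A\<bar> \<le> \<epsilon>"
      using mX mY A by (simp add: measure_distr a_def b_def)
  qed
qed

lemma square_eq_rect: "square N = (\<lambda>t. t + (- int N - 1, - int N - 1)) ` rect (2 * int N + 1) (2 * int N + 1)"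
proof (intro set_eqI iffI)
  fix t assume "t \<in> square N"
  then have "t = (fst t + int N + 1, snd t + int N + 1) + (- int N - 1, - int N - 1)"
    "(fst t + int N + 1, snd t + int N + 1) \<in> rect (2 * int N + 1) (2 * int N + 1)"
    by (auto simp: square_def rect_def)
  then show "t \<in> (\<lambda>t. t + (- int N - 1, - int N - 1)) ` rect (2 * int N + 1) (2 * int N + 1)" by blast
qed (auto simp: square_def rect_def)

text \<open>Both sides are images of one unilateral law on a rectangle with constant boundary
  condition.\<close>

lemma X_law_shift:
  assumes J: "J \<subseteq> square N"
  shows "distr P (PiM J (\<lambda>_. M)) (\<lambda>\<omega>. translate v J (X ((\<lambda>t. t + v) ` square N) x0 \<omega>)) =
    distr P (PiM J (\<lambda>_. M)) (\<lambda>\<omega>. translate 0 J (X (square N) x0 \<omega>))"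
proof -
  define c where "c = (- int N - 1, - int N - 1)"
  define R where "R = rect (2 * int N + 1) (2 * int N + 1)"
  have Rne: "R \<noteq> {}" and Rfin: "finite R" by (simp_all add: R_def rect_def)
  have JR: "t + (- c) \<in> R" if t: "t \<in> J" for t
  proof -
    obtain r where "r \<in> R" "t = r + c"
      using t J unfolding square_eq_rect[of N, folded c_def R_def] by blast
    then show ?thesis by simp
  qed
  have *: "distr P (PiM J (\<lambda>_. M)) (\<lambda>\<omega>. translate w J (X ((\<lambda>t. t + w) ` square N) x0 \<omega>)) =
      distr (unilateral_law E K x0 (2 * int N + 1) (2 * int N + 1)) (PiM J (\<lambda>_. M)) (translate (- c) J)" for w
  proof -
    let ?S = "(\<lambda>t. t + w) ` square N"
    have S: "?S = (\<lambda>t. t + (c + w)) ` R"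
      by (simp add: square_eq_rect[of N, folded c_def R_def] image_image add.assoc)
    have tt: "translate (- c) J (translate (c + w) R y) = translate w J y" for y :: "site \<Rightarrow> 'a"
      using translate_translate[of J "- c" R "c + w" y] JR by simp
    have x0_shift: "(\<lambda>t. x0 (t + (c + w))) = x0" by (simp add: x0_def)
    have "unilateral_law E K x0 (2 * int N + 1) (2 * int N + 1) =
        distr P (PiM R (\<lambda>_. M)) (\<lambda>\<omega>. translate (c + w) R (X ?S x0 \<omega>))"
      using unilateral_law_eq_distr[where x = x0, OF Rne[unfolded R_def] S[unfolded R_def] x0]
      by (simp only: R_def x0_shift)
    also have "distr \<dots> (PiM J (\<lambda>_. M)) (translate (- c) J) =
       distr P (PiM J (\<lambda>_. M)) (translate (- c) J \<circ> (\<lambda>\<omega>. translate (c + w) R (X ?S x0 \<omega>)))"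
      using JR x0 Rfin
      by (intro distr_distr translate_measurable X_translate_measurable) (auto simp: S)
    also have "translate (- c) J \<circ> (\<lambda>\<omega>. translate (c + w) R (X ?S x0 \<omega>)) = (\<lambda>\<omega>. translate w J (X ?S x0 \<omega>))"
      unfolding o_def tt ..
    finally show ?thesis by simp
  qed
  show ?thesis using *[of v] *[of 0] by simp
qed

text \<open>Each side is within \<epsilon>/2 of the law of a finite-domain field, and those two laws
  coincide.\<close>

lemma Y_law_shift:
  assumes J: "finite J"
  shows "distr P (PiM J (\<lambda>_. M)) (\<lambda>\<omega>. translate v J (\<lambda>t. Y t \<omega>)) =
    distr P (PiM J (\<lambda>_. M)) (\<lambda>\<omega>. translate 0 J (\<lambda>t. Y t \<omega>))" (is "?L v = ?L 0")
proof (rule measure_eqI)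
  fix A assume "A \<in> sets (?L v)"
  then have A: "A \<in> sets (PiM J (\<lambda>_. M))" by simp
  have "\<bar>measure (?L v) A - measure (?L 0) A\<bar> \<le> \<epsilon>" if \<epsilon>: "\<epsilon> > 0" for \<epsilon> :: real
  proof -
    obtain N1 N2 where N1: "\<And>S x. finite S \<Longrightarrow> square N1 \<subseteq> S \<Longrightarrow> (\<forall>r\<in>outer_bdry S. x r \<in> E) \<Longrightarrow> (\<forall>t\<in>J. t + v \<in> S) \<Longrightarrow>
      \<bar>measure (distr P (PiM J (\<lambda>_. M)) (\<lambda>\<omega>. translate v J (X S x \<omega>))) A - measure (?L v) A\<bar> \<le> \<epsilon> / 2"
      and N2: "\<And>S x. finite S \<Longrightarrow> square N2 \<subseteq> S \<Longrightarrow> (\<forall>r\<in>outer_bdry S. x r \<in> E) \<Longrightarrow> (\<forall>t\<in>J. t + 0 \<in> S) \<Longrightarrow>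
      \<bar>measure (distr P (PiM J (\<lambda>_. M)) (\<lambda>\<omega>. translate 0 J (X S x \<omega>))) A - measure (?L 0) A\<bar> \<le> \<epsilon> / 2"
      using X_law_close[OF J, of "\<epsilon> / 2" v] X_law_close[OF J, of "\<epsilon> / 2" 0] A \<epsilon> by (metis half_gt_zero)
    \<comment> \<open>Moving \<open>square N1\<close> back by \<open>v\<close> makes the shifted
      square contain \<open>square N1\<close> itself.\<close>
    obtain N where N: "J \<union> (\<lambda>t. t + (- v)) ` square N1 \<union> square N2 \<subseteq> square N"
      using finite_subset_square[of "J \<union> (\<lambda>t. t + (- v)) ` square N1 \<union> square N2"] J finite_square by auto
    have "square N1 \<subseteq> (\<lambda>t. t + v) ` square N"
    proof
      fix t assume "t \<in> square N1"
      then have "t + (- v) \<in> square N" using N by blast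
      then show "t \<in> (\<lambda>t. t + v) ` square N" by (intro image_eqI[of _ _ "t + (- v)"]) auto
    qed
    moreover have "\<forall>t\<in>J. t + v \<in> (\<lambda>t. t + v) ` square N" using N by blast
    ultimately have "\<bar>measure (distr P (PiM J (\<lambda>_. M)) (\<lambda>\<omega>. translate v J (X ((\<lambda>t. t + v) ` square N) x0 \<omega>))) A
        - measure (?L v) A\<bar> \<le> \<epsilon> / 2"
      using x0 finite_square by (intro N1) auto
    moreover have "\<bar>measure (distr P (PiM J (\<lambda>_. M)) (\<lambda>\<omega>. translate 0 J (X (square N) x0 \<omega>))) A
        - measure (?L 0) A\<bar> \<le> \<epsilon> / 2"
      using x0 finite_square N by (intro N2) auto
    moreover have "J \<subseteq> square N" using N by blast
    ultimately show ?thesis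
      unfolding X_law_shift[OF \<open>J \<subseteq> square N\<close>] by linarith
  qed
  then have "measure (?L v) A = measure (?L 0) A"
    by (metis abs_le_zero_iff dense_ge eq_iff_diff_eq_0)
  moreover have "prob_space (?L v)" "prob_space (?L 0)"
    by (rule prob_space_distr[OF Y_translate_measurable])+
  ultimately show "emeasure (?L v) A = emeasure (?L 0) A"
    by (simp add: finite_measure.emeasure_eq_measure prob_space.finite_measure)
qed simp

section \<open>The law of the limit field on the whole lattice\<close>

definition equilibrium :: "(site \<Rightarrow> 'a) measure" where
  "equilibrium = distr P (PiM UNIV (\<lambda>_. M)) (\<lambda>\<omega> t. Y t \<omega>)"

lemma Y_PiM_measurable: "(\<lambda>\<omega> t. Y t \<omega>) \<in> P \<rightarrow>\<^sub>M PiM UNIV (\<lambda>_. M)"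
  using measurable_restrict[of UNIV "\<lambda>t \<omega>. Y t \<omega>" P "\<lambda>_. M"] Y_measurable by (simp add: restrict_def)

lemma distr_equilibrium_translate:
  "distr equilibrium (PiM J (\<lambda>_. M)) (translate v J) = distr P (PiM J (\<lambda>_. M)) (\<lambda>\<omega>. translate v J (\<lambda>t. Y t \<omega>))"
  unfolding equilibrium_def
  by (subst distr_distr) (auto simp: o_def intro: Y_PiM_measurable translate_measurable)

end

text \<open>Cylinder sets over finite \<open>J\<close> generate the product sigma-algebra;
  \<open>translate 0 J\<close> is the restriction to \<open>J\<close>.\<close>

lemma PiM_UNIV_eqI:
  assumes "sets \<mu> = sets (PiM UNIV (\<lambda>_. N))" "sets \<nu> = sets (PiM UNIV (\<lambda>_. N))" "finite_measure \<mu>"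
    and eq: "\<And>J. finite J \<Longrightarrow> distr \<mu> (PiM J (\<lambda>_. N)) (translate 0 J) = distr \<nu> (PiM J (\<lambda>_. N)) (translate 0 J)"
  shows "\<mu> = \<nu>"
proof (rule measure_eqI_PiM_infinite[OF assms(1,2) _ assms(3)])
  fix A and J :: "site set"
  assume J: "finite J" and A: "\<And>i. i \<in> J \<Longrightarrow> A i \<in> sets N"
  have B: "Pi\<^sub>E J A \<in> sets (PiM J (\<lambda>_. N))" using J A by (intro sets_PiM_I_finite)
  have *: "emeasure \<rho> (prod_emb UNIV (\<lambda>_. N) J (Pi\<^sub>E J A)) = emeasure (distr \<rho> (PiM J (\<lambda>_. N)) (translate 0 J)) (Pi\<^sub>E J A)"
    if s: "sets \<rho> = sets (PiM UNIV (\<lambda>_. N))" for \<rho>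
  proof -
    have "translate 0 J \<in> \<rho> \<rightarrow>\<^sub>M PiM J (\<lambda>_. N)"
      using translate_measurable[of J 0 UNIV N] measurable_cong_sets[OF s refl] by blast
    moreover have "space \<rho> = (\<Pi>\<^sub>E i\<in>UNIV. space N)"
      using sets_eq_imp_space_eq[OF s] by (simp add: space_PiM)
    ultimately show ?thesis
      using B by (simp add: emeasure_distr prod_emb_def translate_0)
  qed
  show "emeasure \<mu> (prod_emb UNIV (\<lambda>_. N) J (Pi\<^sub>E J A)) = emeasure \<nu> (prod_emb UNIV (\<lambda>_. N) J (Pi\<^sub>E J A))"
    using *[OF assms(1)] *[OF assms(2)] eq[OF J] by simp
qed

context coupled_field
begin

lemma equilibrium_stationary: "stationary_law E UNIV equilibrium"
  unfolding stationary_law_def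
proof (intro conjI allI impI)
  show ps: "prob_space equilibrium"
    unfolding equilibrium_def by (rule prob_space_distr[OF Y_PiM_measurable])
  show sets: "sets equilibrium = sets (PiM UNIV (\<lambda>_. M))"
    by (simp add: equilibrium_def)
  fix v
  have tm: "translate w A \<in> equilibrium \<rightarrow>\<^sub>M PiM A (\<lambda>_. M)" for w A
    using translate_measurable[of A w UNIV M] measurable_cong_sets[OF sets refl] by blast
  show "distr equilibrium (PiM UNIV (\<lambda>_. M)) (translate v UNIV) = equilibrium"
  proof (rule PiM_UNIV_eqI)
    show "finite_measure (distr equilibrium (PiM UNIV (\<lambda>_. M)) (translate v UNIV))"
      using prob_space.prob_space_distr[OF ps tm] by (rule prob_space.finite_measure)
    fix J :: "site set" assume J: "finite J"
    have "distr (distr equilibrium (PiM UNIV (\<lambda>_. M)) (translate v UNIV)) (PiM J (\<lambda>_. M)) (translate 0 J)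
        = distr equilibrium (PiM J (\<lambda>_. M)) (translate v J)"
      by (subst distr_distr) (auto simp: o_def translate_translate intro!: tm translate_measurable)
    then show "distr (distr equilibrium (PiM UNIV (\<lambda>_. M)) (translate v UNIV)) (PiM J (\<lambda>_. M)) (translate 0 J)
        = distr equilibrium (PiM J (\<lambda>_. M)) (translate 0 J)"
      using Y_law_shift[OF J, of v] by (simp add: distr_equilibrium_translate)
  qed (simp_all add: sets)
qed

end

section \<open>Uniform ergodicity\<close>

lemma stationary_restrict:
  assumes \<mu>: "stationary_law E UNIV \<mu>"
  shows "stationary_law E A (distr \<mu> (PiM A (\<lambda>_. state_space E)) (\<lambda>y. restrict y A))"
proof -
  let ?M = "\<lambda>_::site. state_space E"
  have ps: "prob_space \<mu>" and sets: "sets \<mu> = sets (PiM UNIV ?M)"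
    and shift: "\<And>v. distr \<mu> (PiM UNIV ?M) (translate v UNIV) = \<mu>"
    using \<mu> by (auto simp: stationary_law_def)
  have tm: "translate v B \<in> \<mu> \<rightarrow>\<^sub>M PiM B ?M" for v B
    using translate_measurable[of B v UNIV "state_space E"] measurable_cong_sets[OF sets refl] by blast
  show ?thesis
    unfolding stationary_law_def translate_0[symmetric]
  proof (intro conjI allI impI)
    show "prob_space (distr \<mu> (PiM A ?M) (translate 0 A))"
      by (rule prob_space.prob_space_distr[OF ps tm])
    fix v assume "(\<lambda>t. t + v) ` A \<subseteq> A"
    then have v: "\<And>t. t \<in> A \<Longrightarrow> t + v \<in> A" by blast
    have "distr (distr \<mu> (PiM A ?M) (translate 0 A)) (PiM A ?M) (translate v A) = distr \<mu> (PiM A ?M) (translate v A)"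
      using v by (subst distr_distr[OF translate_measurable tm]) (auto simp: o_def translate_translate)
    also have "\<dots> = distr (distr \<mu> (PiM UNIV ?M) (translate v UNIV)) (PiM A ?M) (translate 0 A)"
      by (subst distr_distr[OF translate_measurable tm]) (auto simp: o_def translate_translate)
    finally show "distr (distr \<mu> (PiM A ?M) (translate 0 A)) (PiM A ?M) (translate v A) = distr \<mu> (PiM A ?M) (translate 0 A)"
      by (simp add: shift)
  qed simp
qed

section \<open>Total variation and fields started from the axes\<close>

lemma tv_dist_le:
  assumes "\<And>A. A \<in> sets \<mu> \<Longrightarrow> \<bar>measure \<mu> A - measure \<nu> A\<bar> \<le> e"
  shows "\<bar>tv_dist \<mu> \<nu>\<bar> \<le> e"
proof -
  have bdd: "bdd_above ((\<lambda>A. \<bar>measure \<mu> A - measure \<nu> A\<bar>) ` sets \<mu>)"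
    using assms by (intro bdd_aboveI[of _ e]) auto
  have "tv_dist \<mu> \<nu> \<le> e"
    unfolding tv_dist_def using assms by (intro cSUP_least) auto
  moreover have "0 \<le> tv_dist \<mu> \<nu>"
    unfolding tv_dist_def using bdd by (intro cSUP_upper2[of _ _ "{}"]) auto
  ultimately show ?thesis by simp
qed

text \<open>A real supremum is an upper bound only for bounded sets; here the bound 1 comes from the
  probability measures.\<close>

lemma le_tv_dist:
  assumes "prob_space \<mu>" "prob_space \<nu>" "A \<in> sets \<mu>"
  shows "\<bar>measure \<mu> A - measure \<nu> A\<bar> \<le> tv_dist \<mu> \<nu>"
proof -
  have "\<bar>measure \<mu> B - measure \<nu> B\<bar> \<le> 1" for B
    using prob_space.prob_le_1[OF assms(1), of B] prob_space.prob_le_1[OF assms(2), of B]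
      measure_nonneg[of \<mu> B] measure_nonneg[of \<nu> B] by linarith
  then have "bdd_above ((\<lambda>A. \<bar>measure \<mu> A - measure \<nu> A\<bar>) ` sets \<mu>)"
    by (intro bdd_aboveI[of _ 1]) auto
  then show ?thesis
    unfolding tv_dist_def using assms(3) by (intro cSUP_upper)
qed

lemma outer_bdry_rect: "outer_bdry ((\<lambda>t. t + v) ` rect m n) \<subseteq> (\<lambda>t. t + v) ` axes"
proof
  fix p assume "p \<in> outer_bdry ((\<lambda>t. t + v) ` rect m n)"
  then obtain t where t: "t \<in> rect m n" "p \<in> parents (t + v)" "p \<notin> (\<lambda>t. t + v) ` rect m n"
    by (auto simp: outer_bdry_def)
  obtain i j where ij: "t = (i, j)" by fastforce
  obtain a b where ab: "v = (a, b)" by fastforce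
  have "p - v \<in> parents t" using t(2) by (auto simp: ij ab)
  moreover have "p - v \<notin> rect m n" using t(3) by (metis diff_add_cancel image_eqI)
  ultimately have "p - v \<in> axes" using t(1) by (auto simp: ij rect_def axes_def)
  then show "p \<in> (\<lambda>t. t + v) ` axes" by (metis diff_add_cancel image_eqI)
qed

lemma axes_boundary:
  assumes "x \<in> axes \<rightarrow>\<^sub>E E" "r \<in> outer_bdry ((\<lambda>t. t + (- v)) ` rect m n)"
  shows "x (r + v) \<in> E"
proof -
  obtain t where "t \<in> axes" "r = t + (- v)"
    using subsetD[OF outer_bdry_rect assms(2)] by blast
  then show ?thesis using assms(1) by auto
qed

context coupled_field
begin

text \<open>Seen from the window, it is the boundary that recedes: the field lives on the rectangle
  shifted by \<open>- v\<close>, and the window stays at \<open>rect m n\<close>.\<close>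

lemma window_law_eq:
  assumes v: "fst v \<ge> 0" "snd v \<ge> 0" and mn: "m \<ge> 1" "n \<ge> 1"
    and x: "x \<in> axes \<rightarrow>\<^sub>E E"
    and S: "S = (\<lambda>t. t + (- v)) ` rect (fst v + m) (snd v + n)"
  shows "unilateral_window_law E K x v m n =
    distr P (PiM (rect m n) (\<lambda>_. M)) (\<lambda>\<omega>. translate 0 (rect m n) (X S (\<lambda>t. x (t + v)) \<omega>))"
proof -
  let ?R = "rect (fst v + m) (snd v + n)"
  have Rne: "?R \<noteq> {}" using v mn by (simp add: rect_def)
  have Sfin: "finite S" by (simp add: S rect_def)
  have xE: "x (r + v) \<in> E" if "r \<in> outer_bdry S" for r
    using axes_boundary[OF x] that unfolding S by blast
  have x_eq: "(\<lambda>t. x (t + - v + v)) = x" by simp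
  have sub: "t + v \<in> ?R" if "t \<in> rect m n" for t
    using that v by (cases v) (auto simp: rect_def)
  have tt: "translate v (rect m n) (translate (- v) ?R y) = translate 0 (rect m n) y" for y :: "site \<Rightarrow> 'a"
    using translate_translate[of "rect m n" v ?R "- v" y] sub by simp
  have "unilateral_law E K x (fst v + m) (snd v + n) =
      distr P (PiM ?R (\<lambda>_. M)) (\<lambda>\<omega>. translate (- v) ?R (X S (\<lambda>t. x (t + v)) \<omega>))"
    using unilateral_law_eq_distr[where x = "\<lambda>t. x (t + v)", OF Rne S xE] by (simp only: x_eq)
  then have "unilateral_window_law E K x v m n =
      distr (distr P (PiM ?R (\<lambda>_. M)) (\<lambda>\<omega>. translate (- v) ?R (X S (\<lambda>t. x (t + v)) \<omega>)))
        (PiM (rect m n) (\<lambda>_. M)) (translate v (rect m n))"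
    by (simp only: unilateral_window_law_def)
  also have "\<dots> = distr P (PiM (rect m n) (\<lambda>_. M))
      (translate v (rect m n) \<circ> (\<lambda>\<omega>. translate (- v) ?R (X S (\<lambda>t. x (t + v)) \<omega>)))"
  proof (intro distr_distr translate_measurable X_translate_measurable Sfin sub xE)
    fix t assume "t \<in> ?R" then show "t + - v \<in> S" unfolding S by (rule imageI)
  qed
  also have "translate v (rect m n) \<circ> (\<lambda>\<omega>. translate (- v) ?R (X S (\<lambda>t. x (t + v)) \<omega>)) =
      (\<lambda>\<omega>. translate 0 (rect m n) (X S (\<lambda>t. x (t + v)) \<omega>))"
    unfolding o_def tt ..
  finally show ?thesis .
qed

lemma window_law_prob_space:
  assumes v: "fst v \<ge> 0" "snd v \<ge> 0" and mn: "m \<ge> 1" "n \<ge> 1" and x: "x \<in> axes \<rightarrow>\<^sub>E E"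
  shows "prob_space (unilateral_window_law E K x v m n)"
proof -
  define S where "S = (\<lambda>t. t + (- v)) ` rect (fst v + m) (snd v + n)"
  have Sfin: "finite S" by (simp add: S_def rect_def)
  have xE: "x (r + v) \<in> E" if "r \<in> outer_bdry S" for r
    using axes_boundary[OF x] that unfolding S_def by blast
  have "t + 0 \<in> S" if "t \<in> rect m n" for t
  proof -
    have "t + v \<in> rect (fst v + m) (snd v + n)" using that v by (cases v) (auto simp: rect_def)
    then show ?thesis unfolding S_def by (intro image_eqI[of _ _ "t + v"]) simp_all
  qed
  then show ?thesis
    unfolding window_law_eq[OF v mn x S_def]
    using xE by (intro prob_space_distr X_translate_measurable Sfin)
qed

lemma equilibrium_limit_law:
  "limit_law E K (distr equilibrium (PiM quadrant (\<lambda>_. M)) (\<lambda>y. restrict y quadrant))"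
  unfolding limit_law_def
proof (intro conjI allI impI)
  show "stationary_law E quadrant (distr equilibrium (PiM quadrant (\<lambda>_. M)) (\<lambda>y. restrict y quadrant))"
    by (rule stationary_restrict[OF equilibrium_stationary])
  fix m n :: int assume mn: "m \<ge> 1" "n \<ge> 1"
  let ?J = "rect m n"
  have Jfin: "finite ?J" by (simp add: rect_def)
  have JQ: "t + 0 \<in> quadrant" if "t \<in> ?J" for t using that by (auto simp: rect_def quadrant_def)
  have eqm: "translate v A \<in> equilibrium \<rightarrow>\<^sub>M PiM A (\<lambda>_. M)" for v A
    using translate_measurable[of A v UNIV M] measurable_cong_sets[of equilibrium "PiM UNIV (\<lambda>_. M)"]
    by (simp add: equilibrium_def)
  have \<nu>: "distr (distr equilibrium (PiM quadrant (\<lambda>_. M)) (\<lambda>y. restrict y quadrant)) (PiM ?J (\<lambda>_. M)) (\<lambda>y. restrict y ?J) =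
      distr P (PiM ?J (\<lambda>_. M)) (\<lambda>\<omega>. translate 0 ?J (\<lambda>t. Y t \<omega>))"
  proof -
    have "distr (distr equilibrium (PiM quadrant (\<lambda>_. M)) (translate 0 quadrant)) (PiM ?J (\<lambda>_. M)) (translate 0 ?J) =
      distr equilibrium (PiM ?J (\<lambda>_. M)) (translate 0 ?J)"
      using JQ by (subst distr_distr[OF translate_measurable eqm]) (auto simp: o_def translate_translate)
    also have "\<dots> = distr P (PiM ?J (\<lambda>_. M)) (\<lambda>\<omega>. translate 0 ?J (\<lambda>t. Y t \<omega>))"
      by (rule distr_equilibrium_translate)
    finally show ?thesis by (simp only: translate_0)
  qed
  show "uniform_limit (axes \<rightarrow>\<^sub>E E)
          (\<lambda>v x. tv_dist (unilateral_window_law E K x v m n)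
             (distr (distr equilibrium (PiM quadrant (\<lambda>_. M)) (\<lambda>y. restrict y quadrant))
                (PiM ?J (\<lambda>_. M)) (\<lambda>y. restrict y ?J)))
          (\<lambda>_. 0) (at_top \<times>\<^sub>F at_top)"
    unfolding uniform_limit_iff \<nu>
  proof (intro allI impI)
    fix e :: real assume e: "e > 0"
    then obtain N where N: "\<And>S x A. finite S \<Longrightarrow> square N \<subseteq> S \<Longrightarrow> (\<forall>r\<in>outer_bdry S. x r \<in> E) \<Longrightarrow>
        (\<forall>t\<in>?J. t + 0 \<in> S) \<Longrightarrow> A \<in> sets (PiM ?J (\<lambda>_. M)) \<Longrightarrow>
      \<bar>measure (distr P (PiM ?J (\<lambda>_. M)) (\<lambda>\<omega>. translate 0 ?J (X S x \<omega>))) A -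
       measure (distr P (PiM ?J (\<lambda>_. M)) (\<lambda>\<omega>. translate 0 ?J (\<lambda>t. Y t \<omega>))) A\<bar> \<le> e / 2"
      using X_law_close[OF Jfin, of "e / 2" 0] by (metis half_gt_zero)
    have "dist (tv_dist (unilateral_window_law E K x v m n)
        (distr P (PiM ?J (\<lambda>_. M)) (\<lambda>\<omega>. translate 0 ?J (\<lambda>t. Y t \<omega>)))) 0 < e"
      \<comment> \<open>The shifted rectangle starts at 1 - v in each coordinate, which must be at
        most - N.\<close>
      if v: "fst v \<ge> int N + 1" "snd v \<ge> int N + 1" and x: "x \<in> axes \<rightarrow>\<^sub>E E" for v x
    proof -
      obtain a b where ab: "v = (a, b)" by fastforce
      define S where "S = (\<lambda>t. t + (- v)) ` rect (fst v + m) (snd v + n)"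
      \<comment> \<open>\<open>S\<close> ends at (m, n) and may miss the upper right part of
        \<open>square N\<close>. Extending it there by \<open>N\<close> leaves the window unchanged,
        by \<open>field_local\<close>.\<close>
      define S' where "S' = (\<lambda>t. t + (- v)) ` rect (fst v + m + int N) (snd v + n + int N)"
      have fin: "finite S" "finite S'" by (simp_all add: S_def S'_def rect_def)
      have memS: "t \<in> S \<longleftrightarrow> t + v \<in> rect (fst v + m) (snd v + n)" for t
        unfolding S_def by (auto intro!: image_eqI[of _ _ "t + v"])
      have memS': "t \<in> S' \<longleftrightarrow> t + v \<in> rect (fst v + m + int N) (snd v + n + int N)" for t
        unfolding S'_def by (auto intro!: image_eqI[of _ _ "t + v"])
      have eq: "X S x' \<omega> t = X S' x' \<omega> t" if "t \<in> ?J" for x' t \<omega>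
      proof (rule field_local[OF fin])
        fix r :: site assume "fst r \<le> fst t" "snd r \<le> snd t"
        then show "r \<in> S \<longleftrightarrow> r \<in> S'"
          using that by (cases r; cases t) (auto simp: memS memS' ab rect_def)
      qed
      have "unilateral_window_law E K x v m n =
          distr P (PiM ?J (\<lambda>_. M)) (\<lambda>\<omega>. translate 0 ?J (X S (\<lambda>t. x (t + v)) \<omega>))"
        using v by (intro window_law_eq mn x S_def) auto
      also have "(\<lambda>\<omega>. translate 0 ?J (X S (\<lambda>t. x (t + v)) \<omega>)) = (\<lambda>\<omega>. translate 0 ?J (X S' (\<lambda>t. x (t + v)) \<omega>))"
        by (intro ext translate_cong) (simp add: eq)
      finally have law: "unilateral_window_law E K x v m n =
          distr P (PiM ?J (\<lambda>_. M)) (\<lambda>\<omega>. translate 0 ?J (X S' (\<lambda>t. x (t + v)) \<omega>))" .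
      have "\<bar>tv_dist (unilateral_window_law E K x v m n)
        (distr P (PiM ?J (\<lambda>_. M)) (\<lambda>\<omega>. translate 0 ?J (\<lambda>t. Y t \<omega>)))\<bar> \<le> e / 2"
        unfolding law
      proof (intro tv_dist_le N fin)
        show "square N \<subseteq> S'"
        proof
          fix t assume "t \<in> square N"
          then show "t \<in> S'" using v mn by (cases t) (auto simp: memS' square_def rect_def ab)
        qed
        show "\<forall>t\<in>?J. t + 0 \<in> S'"
        proof
          fix t assume "t \<in> ?J"
          then show "t + 0 \<in> S'" using v mn by (cases t) (auto simp: memS' rect_def ab)
        qed
        show "\<forall>r\<in>outer_bdry S'. x (r + v) \<in> E"
          using axes_boundary[OF x] unfolding S'_def by blast
      qed simp
      then show ?thesis using e by (simp add: dist_real_def)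
    qed
    moreover have "eventually (\<lambda>v. fst v \<ge> int N + 1 \<and> snd v \<ge> int N + 1) (at_top \<times>\<^sub>F at_top :: site filter)"
      using eventually_prodI[OF eventually_ge_at_top[of "int N + 1"] eventually_ge_at_top[of "int N + 1"]] by (simp add: case_prod_beta)
    ultimately show "eventually (\<lambda>v. \<forall>x\<in>axes \<rightarrow>\<^sub>E E. dist (tv_dist (unilateral_window_law E K x v m n)
        (distr P (PiM ?J (\<lambda>_. M)) (\<lambda>\<omega>. translate 0 ?J (\<lambda>t. Y t \<omega>)))) 0 < e) (at_top \<times>\<^sub>F at_top)"
      by (auto elim!: eventually_mono)
  qed
qed

lemma equilibrium_law: "equilibrium_law E K equilibrium"
  unfolding equilibrium_law_def using equilibrium_stationary equilibrium_limit_law by blast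

text \<open>Both limits are compared with one window law at a common distant \<open>v\<close>, for a
  single boundary condition.\<close>

lemma limit_law_unique:
  assumes \<mu>: "limit_law E K \<mu>" and \<nu>: "limit_law E K \<nu>" and mn: "m \<ge> 1" "n \<ge> 1"
  shows "distr \<mu> (PiM (rect m n) (\<lambda>_. M)) (\<lambda>y. restrict y (rect m n)) =
    distr \<nu> (PiM (rect m n) (\<lambda>_. M)) (\<lambda>y. restrict y (rect m n))" (is "?d \<mu> = ?d \<nu>")
proof (rule measure_eqI)
  let ?J = "rect m n"
  have JQ: "t + 0 \<in> quadrant" if "t \<in> ?J" for t using that by (auto simp: rect_def quadrant_def)
  have ps: "prob_space (?d \<rho>)" if "limit_law E K \<rho>" for \<rho>
  proof -
    have \<rho>: "prob_space \<rho>" "sets \<rho> = sets (PiM quadrant (\<lambda>_. M))"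
      using that by (auto simp: limit_law_def stationary_law_def)
    have "translate 0 ?J \<in> \<rho> \<rightarrow>\<^sub>M PiM ?J (\<lambda>_. M)"
      using translate_measurable[of ?J 0 quadrant M, OF JQ] measurable_cong_sets[OF \<rho>(2) refl] by blast
    then show ?thesis unfolding translate_0 by (rule prob_space.prob_space_distr[OF \<rho>(1)])
  qed
  obtain x where x: "x \<in> axes \<rightarrow>\<^sub>E E"
    using E_nonempty by (metis PiE_eq_empty_iff ex_in_conv)
  fix A assume "A \<in> sets (?d \<mu>)"
  then have A: "A \<in> sets (PiM ?J (\<lambda>_. M))" by simp
  have "\<bar>measure (?d \<mu>) A - measure (?d \<nu>) A\<bar> \<le> e" if e: "e > 0" for e :: real
  proof -
    have ev: "eventually (\<lambda>v. \<forall>x\<in>axes \<rightarrow>\<^sub>E E. dist (tv_dist (unilateral_window_law E K x v m n) (?d \<rho>)) 0 < e / 2)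
        (at_top \<times>\<^sub>F at_top)" if \<rho>: "limit_law E K \<rho>" for \<rho>
    proof -
      have "uniform_limit (axes \<rightarrow>\<^sub>E E) (\<lambda>v x. tv_dist (unilateral_window_law E K x v m n) (?d \<rho>))
          (\<lambda>_. 0) (at_top \<times>\<^sub>F at_top)"
        using \<rho> mn unfolding limit_law_def by blast
      from uniform_limitD[OF this half_gt_zero[OF e]] show ?thesis .
    qed
    \<comment> \<open>Nonnegative \<open>v\<close> makes the window law a probability measure, as
      the estimates by \<open>tv_dist\<close> require.\<close>
    have "eventually (\<lambda>v. fst v \<ge> 0 \<and> snd v \<ge> 0) (at_top \<times>\<^sub>F at_top :: site filter)"
      using eventually_prodI[OF eventually_ge_at_top[of "0::int"] eventually_ge_at_top[of "0::int"]] by (simp add: case_prod_beta)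
    with ev[OF \<mu>] ev[OF \<nu>] have "eventually (\<lambda>v. (\<forall>x\<in>axes \<rightarrow>\<^sub>E E. dist (tv_dist (unilateral_window_law E K x v m n) (?d \<mu>)) 0 < e / 2)
       \<and> (\<forall>x\<in>axes \<rightarrow>\<^sub>E E. dist (tv_dist (unilateral_window_law E K x v m n) (?d \<nu>)) 0 < e / 2) \<and> fst v \<ge> 0 \<and> snd v \<ge> 0)
       (at_top \<times>\<^sub>F at_top :: site filter)"
      by eventually_elim blast
    moreover have "(at_top \<times>\<^sub>F at_top :: site filter) \<noteq> bot"
      by (simp add: prod_filter_eq_bot)
    ultimately have "\<exists>v. (\<forall>x\<in>axes \<rightarrow>\<^sub>E E. dist (tv_dist (unilateral_window_law E K x v m n) (?d \<mu>)) 0 < e / 2)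
       \<and> (\<forall>x\<in>axes \<rightarrow>\<^sub>E E. dist (tv_dist (unilateral_window_law E K x v m n) (?d \<nu>)) 0 < e / 2) \<and> fst v \<ge> 0 \<and> snd v \<ge> 0"
      by (rule eventually_happens'[rotated])
    then obtain v where
       d: "\<And>x. x \<in> axes \<rightarrow>\<^sub>E E \<Longrightarrow> dist (tv_dist (unilateral_window_law E K x v m n) (?d \<mu>)) 0 < e / 2"
         "\<And>x. x \<in> axes \<rightarrow>\<^sub>E E \<Longrightarrow> dist (tv_dist (unilateral_window_law E K x v m n) (?d \<nu>)) 0 < e / 2"
       and v: "fst v \<ge> 0" "snd v \<ge> 0"
      by (elim exE conjE) blast
    let ?w = "unilateral_window_law E K x v m n"
    have w: "prob_space ?w" using window_law_prob_space[OF v mn x] .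
    have Aw: "A \<in> sets ?w" using A by (simp add: unilateral_window_law_def)
    show ?thesis
      using le_tv_dist[OF w ps[OF \<mu>] Aw] le_tv_dist[OF w ps[OF \<nu>] Aw] d[OF x]
      by (simp add: dist_real_def)
  qed
  then have "measure (?d \<mu>) A = measure (?d \<nu>) A"
    by (metis abs_le_zero_iff dense_ge eq_iff_diff_eq_0)
  then show "emeasure (?d \<mu>) A = emeasure (?d \<nu>) A"
    using ps[OF \<mu>] ps[OF \<nu>] by (simp add: finite_measure.emeasure_eq_measure prob_space.finite_measure)
qed simp

text \<open>Limit laws are identified only on rectangles starting at (1, 1); stationarity moves an
  arbitrary finite \<Lambda> into one of them.\<close>

lemma equilibrium_law_unique:
  assumes \<mu>: "equilibrium_law E K \<mu>" and \<Lambda>: "finite \<Lambda>"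
  shows "distr \<mu> (PiM \<Lambda> (\<lambda>_. M)) (\<lambda>y. restrict y \<Lambda>) = distr equilibrium (PiM \<Lambda> (\<lambda>_. M)) (\<lambda>y. restrict y \<Lambda>)"
proof -
  obtain N where N: "\<Lambda> \<subseteq> square N" using finite_subset_square[OF \<Lambda>] by blast
  \<comment> \<open>A square of side 2 N + 1 whose lower left corner \<open>c\<close> moves from (-
    N, - N) to (1, 1).\<close>
  define m where "m = 2 * int N + 1"
  define c where "c = (int N + 1, int N + 1)"
  have mem: "t + c \<in> rect m m" if "t \<in> \<Lambda>" for t
    using subsetD[OF N that] by (cases t) (auto simp: square_def rect_def m_def c_def)
  have JQ: "t + 0 \<in> quadrant" if "t \<in> rect m m" for t using that by (auto simp: rect_def quadrant_def)
  have *: "distr \<rho> (PiM \<Lambda> (\<lambda>_. M)) (\<lambda>y. restrict y \<Lambda>) =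
     distr (distr (distr \<rho> (PiM quadrant (\<lambda>_. M)) (\<lambda>y. restrict y quadrant)) (PiM (rect m m) (\<lambda>_. M)) (\<lambda>y. restrict y (rect m m)))
       (PiM \<Lambda> (\<lambda>_. M)) (translate c \<Lambda>)" if "equilibrium_law E K \<rho>" for \<rho>
  proof -
    have sets: "sets \<rho> = sets (PiM UNIV (\<lambda>_. M))" and shift: "distr \<rho> (PiM UNIV (\<lambda>_. M)) (translate c UNIV) = \<rho>"
      using that unfolding equilibrium_law_def stationary_law_def by blast+
    have tm: "translate v B \<in> \<rho> \<rightarrow>\<^sub>M PiM B (\<lambda>_. M)" for v B
      using translate_measurable[of B v UNIV M] measurable_cong_sets[OF sets refl] by blast
    have "distr (distr (distr \<rho> (PiM quadrant (\<lambda>_. M)) (translate 0 quadrant)) (PiM (rect m m) (\<lambda>_. M)) (translate 0 (rect m m)))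
       (PiM \<Lambda> (\<lambda>_. M)) (translate c \<Lambda>) =
       distr (distr \<rho> (PiM (rect m m) (\<lambda>_. M)) (translate 0 (rect m m))) (PiM \<Lambda> (\<lambda>_. M)) (translate c \<Lambda>)"
      using JQ by (subst distr_distr[OF translate_measurable tm]) (auto simp: o_def translate_translate)
    also have "\<dots> = distr \<rho> (PiM \<Lambda> (\<lambda>_. M)) (translate c \<Lambda>)"
      using mem by (subst distr_distr[OF translate_measurable tm]) (auto simp: o_def translate_translate)
    also have "\<dots> = distr (distr \<rho> (PiM UNIV (\<lambda>_. M)) (translate c UNIV)) (PiM \<Lambda> (\<lambda>_. M)) (translate 0 \<Lambda>)"
      by (subst distr_distr[OF translate_measurable tm]) (auto simp: o_def translate_translate)
    finally show ?thesis unfolding shift unfolding translate_0 by simp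
  qed
  have "m \<ge> 1" by (simp add: m_def)
  with limit_law_unique[of "distr \<mu> (PiM quadrant (\<lambda>_. M)) (\<lambda>y. restrict y quadrant)"
      "distr equilibrium (PiM quadrant (\<lambda>_. M)) (\<lambda>y. restrict y quadrant)" m m] \<mu> equilibrium_law
  show ?thesis
    unfolding *[OF \<mu>] *[OF equilibrium_law] by (simp add: equilibrium_law_def)
qed

end

section \<open>The random region\<close>

context coupled_field
begin

text \<open>The two configurations are fixed by different families of domains; a finite domain
  containing both the carried sites and the influence set belongs to each.\<close>

lemma \<Upsilon>_eq_Y:
  assumes \<omega>: "\<omega> \<in> space P" and \<Lambda>: "finite \<Lambda>" "union_of_blocks l d (inner_bdry \<Lambda>)"
    and fin: "finite (D l d (\<lambda>v. W v \<omega>) \<Lambda>)" "\<And>t. t \<in> \<Lambda> \<Longrightarrow> finite (influence t \<omega>)"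
    and t: "t \<in> \<Lambda>"
  shows "\<Upsilon> E s l d (D l d (\<lambda>v. W v \<omega>) \<Lambda>) (\<lambda>t. U t \<omega>) t = Y t \<omega>"
proof -
  let ?B = "D l d (\<lambda>v. W v \<omega>) \<Lambda>"
  define S where "S = carried_sites l d ?B \<union> influence t \<omega>"
  have S: "finite S" "carried_sites l d ?B \<subseteq> S"
    using finite_carried_sites[OF l fin(1)] fin(2)[OF t] by (auto simp: S_def)
  obtain x where x: "x \<in> outer_bdry S \<rightarrow>\<^sub>E E" using ex_boundary by blast
  have "restrict (field s l d S x (\<lambda>t. U t \<omega>)) ?B = \<Upsilon> E s l d ?B (\<lambda>t. U t \<omega>)"
    using determined_\<Upsilon>[OF \<omega> \<Lambda> fin(1)] S x unfolding determined_def by blast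
  moreover have "t \<in> ?B" using t by (simp add: D_def)
  ultimately have "\<Upsilon> E s l d ?B (\<lambda>t. U t \<omega>) t = X S x \<omega> t"
    by (metis restrict_apply')
  also have "\<dots> = Y t \<omega>"
    using x by (intro Y_eq[OF \<omega> S(1)]) (auto simp: S_def)
  finally show ?thesis .
qed

section \<open>Cardinality of the random region\<close>

abbreviation "bdry_blocks \<Lambda> \<equiv> {v \<in> V d. block l v \<subseteq> inner_bdry \<Lambda>}"

lemma D_eq: "D l d (\<lambda>v. W v \<omega>) \<Lambda> = \<Lambda> \<union> (\<Union>v\<in>Cl (bdry_blocks \<Lambda>) \<omega>. block l v)"
  by (simp add: D_def \<sigma>_eq_cluster)

lemma bdry_blocks:
  assumes "finite \<Lambda>"
  shows "finite (bdry_blocks \<Lambda>)" "card (bdry_blocks \<Lambda>) \<le> card (inner_bdry \<Lambda>)"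
proof -
  have fin: "finite (inner_bdry \<Lambda>)" using assms by (simp add: inner_bdry_def)
  have inj: "inj_on (\<lambda>v. (l, 1) + offset l v) (bdry_blocks \<Lambda>)"
    using inj_corner[OF l] by (rule inj_on_subset) simp
  have sub: "(\<lambda>v. (l, 1) + offset l v) ` bdry_blocks \<Lambda> \<subseteq> inner_bdry \<Lambda>"
    using corner_block[OF l] by blast
  show "finite (bdry_blocks \<Lambda>)"
    using finite_imageD[OF finite_subset[OF sub fin] inj] .
  show "card (bdry_blocks \<Lambda>) \<le> card (inner_bdry \<Lambda>)"
    using card_inj_on_le[OF inj sub fin] .
qed

lemma AE_finite_D:
  assumes "finite \<Lambda>"
  shows "AE \<omega> in P. finite (D l d (\<lambda>v. W v \<omega>) \<Lambda>)"
  using AE_finite_cluster[of "bdry_blocks \<Lambda>"] bdry_blocks(1)[OF assms] assms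
  by (auto simp: D_eq finite_block elim!: eventually_mono)

lemma D_mem_event: "{\<omega> \<in> space P. t \<in> D l d (\<lambda>v. W v \<omega>) \<Lambda>} \<in> events"
proof (cases "t \<in> \<Lambda>")
  case False
  then have "{\<omega> \<in> space P. t \<in> D l d (\<lambda>v. W v \<omega>) \<Lambda>} =
      (\<Union>v\<in>{v. t \<in> block l v}. {\<omega> \<in> space P. v \<in> Cl (bdry_blocks \<Lambda>) \<omega>})"
    unfolding D_eq by blast
  also have "\<dots> \<in> events"
    using cluster_event[of "bdry_blocks \<Lambda>"] by (intro sets.countable_UN'') auto
  finally show ?thesis .
qed (simp add: D_def)

lemma D_eq_event: "{\<omega> \<in> space P. D l d (\<lambda>v. W v \<omega>) \<Lambda> = F} \<in> events"
proof -
  have "{\<omega> \<in> space P. t \<in> D l d (\<lambda>v. W v \<omega>) \<Lambda> \<longleftrightarrow> t \<in> F} \<in> events" for t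
    using D_mem_event[of t \<Lambda>] by (cases "t \<in> F") (simp_all add: sets.sets_Collect_neg)
  then have "{\<omega> \<in> space P. \<forall>t. t \<in> D l d (\<lambda>v. W v \<omega>) \<Lambda> \<longleftrightarrow> t \<in> F} \<in> events"
    by (rule sets.sets_Collect_countable_All)
  then show ?thesis by (simp add: set_eq_iff)
qed

text \<open>There are only countably many finite sets of sites, and the event that \<open>D\<close>
  equals a given one is measurable.\<close>

lemma card_D_measurable: "(\<lambda>\<omega>. real (card (D l d (\<lambda>v. W v \<omega>) \<Lambda>))) \<in> borel_measurable P"
proof -
  let ?D = "\<lambda>\<omega>. D l d (\<lambda>v. W v \<omega>) \<Lambda>"
  have union: "(\<Union>F\<in>\<F>. {\<omega> \<in> space P. ?D \<omega> = F}) \<in> events" if "\<F> \<subseteq> {F. finite F}" for \<F>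
    using countable_subset[OF that countable_Collect_finite] D_eq_event
    by (intro sets.countable_UN'')
  have "(\<lambda>\<omega>. card (?D \<omega>)) -` {n} \<inter> space P \<in> events" for n
  proof (cases "n = 0")
    \<comment> \<open>\<open>card\<close> is 0 also when \<open>D\<close> is infinite, so this case
      is treated through the complement.\<close>
    case True
    have "(\<lambda>\<omega>. card (?D \<omega>)) -` {n} \<inter> space P =
        space P - (\<Union>F\<in>{F. finite F \<and> card F \<noteq> 0}. {\<omega> \<in> space P. ?D \<omega> = F})"
      using True by (auto simp del: card_eq_0_iff)
    then show ?thesis using union[of "{F. finite F \<and> card F \<noteq> 0}"] by auto
  next
    case False
    then have "(\<lambda>\<omega>. card (?D \<omega>)) -` {n} \<inter> space P =
        (\<Union>F\<in>{F. finite F \<and> card F = n}. {\<omega> \<in> space P. ?D \<omega> = F})"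
      by (auto intro: card_ge_0_finite)
    then show ?thesis using union[of "{F. finite F \<and> card F = n}"] by auto
  qed
  then have "(\<lambda>\<omega>. card (?D \<omega>)) \<in> P \<rightarrow>\<^sub>M count_space UNIV"
    by (simp add: measurable_count_space_eq_countable)
  then show ?thesis by simp
qed

lemma card_D_le:
  assumes \<Lambda>: "finite \<Lambda>" and \<omega>: "\<omega> \<in> space P"
  shows "ennreal (real (card (D l d (\<lambda>v. W v \<omega>) \<Lambda>))) \<le>
    ennreal (real (card \<Lambda>)) + ennreal (real_of_int l) * path_count (bdry_blocks \<Lambda>) \<omega>"
proof -
  let ?Cl = "Cl (bdry_blocks \<Lambda>) \<omega>"
  have le: "emeasure (count_space UNIV) ?Cl \<le> path_count (bdry_blocks \<Lambda>) \<omega>"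
    using bdry_blocks(1)[OF \<Lambda>] by (intro cluster_le_path_count \<omega>) auto
  show ?thesis
  proof (cases "finite ?Cl")
    case True
    have "card (D l d (\<lambda>v. W v \<omega>) \<Lambda>) \<le> card \<Lambda> + card (\<Union>v\<in>?Cl. block l v)"
      unfolding D_eq by (rule card_Un_le)
    also have "card (\<Union>v\<in>?Cl. block l v) \<le> (\<Sum>v\<in>?Cl. card (block l v))"
      using True by (rule card_UN_le)
    also have "\<dots> \<le> (\<Sum>v\<in>?Cl. nat l)"
      using l by (intro sum_mono card_block_le) simp
    finally have "real (card (D l d (\<lambda>v. W v \<omega>) \<Lambda>)) \<le> real (card \<Lambda> + card ?Cl * nat l)"
      by (simp only: of_nat_le_iff sum_constant of_nat_id)
    also have "\<dots> = real (card \<Lambda>) + real_of_int l * real (card ?Cl)"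
      using l by simp
    finally have "ennreal (real (card (D l d (\<lambda>v. W v \<omega>) \<Lambda>))) \<le> ennreal (real (card \<Lambda>) + real_of_int l * real (card ?Cl))"
      by (rule ennreal_leI)
    also have "\<dots> = ennreal (real (card \<Lambda>)) + ennreal (real_of_int l) * emeasure (count_space UNIV) ?Cl"
      using l True by (simp add: ennreal_mult ennreal_of_nat_eq_real_of_nat)
    also have "\<dots> \<le> ennreal (real (card \<Lambda>)) + ennreal (real_of_int l) * path_count (bdry_blocks \<Lambda>) \<omega>"
      using le by (intro add_left_mono mult_left_mono) auto
    finally show ?thesis .
  next
    case False
    \<comment> \<open>For an infinite cluster the bound becomes trivial.\<close>
    then have "path_count (bdry_blocks \<Lambda>) \<omega> = \<top>"
      using le by (simp add: top_unique)
    then show ?thesis using l by (simp add: ennreal_mult_top)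
  qed
qed

text \<open>The constant is at most \<open>l\<close> sites per block times the bound 1 / (1 -
  \<theta>) on the expected number of paths from each boundary block; boundary blocks are at most as
  many as boundary sites.\<close>

lemma expectation_card_D:
  assumes \<Lambda>: "finite \<Lambda>"
  shows "integrable P (\<lambda>\<omega>. real (card (D l d (\<lambda>v. W v \<omega>) \<Lambda>)))"
    and "\<bar>(\<integral>\<omega>. real (card (D l d (\<lambda>v. W v \<omega>) \<Lambda>)) \<partial>P) - real (card \<Lambda>)\<bar>
         \<le> real_of_int l / (1 - \<theta>) * real (card (inner_bdry \<Lambda>))"
proof -
  let ?f = "\<lambda>\<omega>. real (card (D l d (\<lambda>v. W v \<omega>) \<Lambda>))"
  let ?A = "bdry_blocks \<Lambda>"
  let ?c = "real (card \<Lambda>) + real_of_int l * (real (card ?A) / (1 - \<theta>))"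
  have A: "?A \<subseteq> V d" by blast
  have "(\<integral>\<^sup>+ \<omega>. ennreal (?f \<omega>) \<partial>P) \<le>
      (\<integral>\<^sup>+ \<omega>. ennreal (real (card \<Lambda>)) + ennreal (real_of_int l) * path_count ?A \<omega> \<partial>P)"
    by (intro nn_integral_mono card_D_le[OF \<Lambda>])
  also have "\<dots> = ennreal (real (card \<Lambda>)) + ennreal (real_of_int l) * (\<integral>\<^sup>+ \<omega>. path_count ?A \<omega> \<partial>P)"
    using path_count_measurable[OF A] by (simp add: nn_integral_add nn_integral_cmult emeasure_space_1)
  also have "\<dots> \<le> ennreal (real (card \<Lambda>)) + ennreal (real_of_int l) * ennreal (real (card ?A) / (1 - \<theta>))"
    by (intro add_left_mono mult_left_mono nn_integral_path_count[OF A]) simp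
  also have "\<dots> = ennreal ?c"
    using l \<theta> by (subst ennreal_mult[symmetric]) (simp_all add: ennreal_plus[symmetric] del: ennreal_plus)
  finally have le: "(\<integral>\<^sup>+ \<omega>. ennreal (?f \<omega>) \<partial>P) \<le> ennreal ?c" .
  then have fin: "(\<integral>\<^sup>+ \<omega>. ennreal (?f \<omega>) \<partial>P) < \<infinity>"
    by (rule order.strict_trans1) simp
  show int: "integrable P ?f"
    using fin by (intro integrableI_nonneg card_D_measurable) auto
  have "ennreal (\<integral>\<omega>. ?f \<omega> \<partial>P) \<le> ennreal ?c"
    using le nn_integral_eq_integral[OF int] by simp
  then have upper: "(\<integral>\<omega>. ?f \<omega> \<partial>P) \<le> ?c"
    using l \<theta> by (subst (asm) ennreal_le_iff) simp_all
  \<comment> \<open>\<Lambda> is part of \<open>D\<close>, but comparing cardinalities needs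
    \<open>D\<close> finite, hence only almost everywhere.\<close>
  have "AE \<omega> in P. real (card \<Lambda>) \<le> ?f \<omega>"
    using AE_finite_D[OF \<Lambda>] by eventually_elim (auto simp: D_def intro!: card_mono)
  then have "(\<integral>\<omega>. real (card \<Lambda>) \<partial>P) \<le> (\<integral>\<omega>. ?f \<omega> \<partial>P)"
    using int by (intro integral_mono_AE) auto
  then have lower: "real (card \<Lambda>) \<le> (\<integral>\<omega>. ?f \<omega> \<partial>P)"
    by (simp add: prob_space)
  have "real_of_int l * (real (card ?A) / (1 - \<theta>)) = real_of_int l / (1 - \<theta>) * real (card ?A)"
    by simp
  also have "\<dots> \<le> real_of_int l / (1 - \<theta>) * real (card (inner_bdry \<Lambda>))"
    using bdry_blocks(2)[OF \<Lambda>] l \<theta> by (intro mult_left_mono) auto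
  finally show "\<bar>(\<integral>\<omega>. ?f \<omega> \<partial>P) - real (card \<Lambda>)\<bar> \<le> real_of_int l / (1 - \<theta>) * real (card (inner_bdry \<Lambda>))"
    using upper lower by linarith
qed

text \<open>The witness is the restriction of \<open>Y\<close>: it is measurable everywhere, whereas
  \<Upsilon> is under control only almost everywhere, where the two agree.\<close>

lemma equilibrium_on_region:
  assumes \<mu>: "equilibrium_law E K \<mu>" and \<Lambda>: "finite \<Lambda>" "union_of_blocks l d (inner_bdry \<Lambda>)"
  shows "\<exists>Y' \<in> P \<rightarrow>\<^sub>M PiM \<Lambda> (\<lambda>_. M).
     (AE \<omega> in P.
        let B = D l d (\<lambda>v. W v \<omega>) \<Lambda>; u = (\<lambda>t. U t \<omega>)
        in finite B \<and> determined E s l d B u (\<Upsilon> E s l d B u) \<and> Y' \<omega> = restrict (\<Upsilon> E s l d B u) \<Lambda>) \<and>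
     distr P (PiM \<Lambda> (\<lambda>_. M)) Y' = distr \<mu> (PiM \<Lambda> (\<lambda>_. M)) (\<lambda>y. restrict y \<Lambda>)"
proof (intro bexI conjI)
  let ?Y = "\<lambda>\<omega>. restrict (\<lambda>t. Y t \<omega>) \<Lambda>"
  show "?Y \<in> P \<rightarrow>\<^sub>M PiM \<Lambda> (\<lambda>_. M)"
    by (intro measurable_restrict Y_measurable)
  have "AE \<omega> in P. \<forall>t\<in>\<Lambda>. finite (influence t \<omega>)"
    using \<Lambda>(1) AE_finite_influence by (simp add: AE_ball_countable countable_finite)
  with AE_finite_D[OF \<Lambda>(1)] AE_space
  show "AE \<omega> in P. let B = D l d (\<lambda>v. W v \<omega>) \<Lambda>; u = (\<lambda>t. U t \<omega>)
        in finite B \<and> determined E s l d B u (\<Upsilon> E s l d B u) \<and> ?Y \<omega> = restrict (\<Upsilon> E s l d B u) \<Lambda>"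
  proof eventually_elim
    case (elim \<omega>)
    then have "?Y \<omega> = restrict (\<Upsilon> E s l d (D l d (\<lambda>v. W v \<omega>) \<Lambda>) (\<lambda>t. U t \<omega>)) \<Lambda>"
      using \<Lambda> by (intro restrict_ext \<Upsilon>_eq_Y[symmetric]) auto
    then show ?case
      using elim determined_\<Upsilon>[OF _ \<Lambda>] by (simp only: Let_def)
  qed
  show "distr P (PiM \<Lambda> (\<lambda>_. M)) ?Y = distr \<mu> (PiM \<Lambda> (\<lambda>_. M)) (\<lambda>y. restrict y \<Lambda>)"
    using distr_equilibrium_translate[of \<Lambda> 0] equilibrium_law_unique[OF \<mu> \<Lambda>(1)]
    by (simp add: translate_0)
qed

end

theorem theorem4p2:
  fixes E :: "'a::polish_space set"
    and K :: "'a \<times> 'a \<Rightarrow> 'a measure"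
    and l d :: int
    and s :: "int \<Rightarrow> real \<Rightarrow> 'a \<Rightarrow> 'a \<Rightarrow> 'a"
    and P :: "'w measure"
    and U :: "site \<Rightarrow> 'w \<Rightarrow> real"
    and W :: "site \<Rightarrow> 'w \<Rightarrow> nat"
    and \<psi> :: "(site \<Rightarrow> real) \<Rightarrow> nat"
    and \<Phi> :: "(site \<Rightarrow> real) \<Rightarrow> site \<Rightarrow> 'a"
    and \<delta> :: real
  assumes E: "E \<in> sets borel"
    and K: "transition_kernel E K"
    and l: "l \<ge> 1" and d: "d \<ge> 2"
    and coupling: "coupling_functions E K l d s"
    and field_measurable: "\<And>S x. finite S \<Longrightarrow> x \<in> outer_bdry S \<rightarrow>\<^sub>E E \<Longrightarrow>
          (\<lambda>u. restrict (field s l d S x u) S)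
            \<in> PiM S (\<lambda>_. unif01) \<rightarrow>\<^sub>M PiM S (\<lambda>_. state_space E)"
    and P: "prob_space P"
    and U_indep: "prob_space.indep_vars P (\<lambda>_. unif01) U UNIV"
    and U_unif: "\<And>t. distr P unif01 (U t) = unif01"
    and \<psi>: "\<psi> \<in> PiM (region l d (0, 0)) (\<lambda>_. unif01) \<rightarrow>\<^sub>M count_space {0, 1}"
    and \<Phi>: "\<Phi> \<in> PiM (region l d (0, 0)) (\<lambda>_. unif01)
               \<rightarrow>\<^sub>M PiM (block l (0, 0)) (\<lambda>_. state_space E)"
    and W: "\<And>v \<omega>. v \<in> V d \<Longrightarrow> \<omega> \<in> space P \<Longrightarrow>
          W v \<omega> = \<psi> (translate (offset l v) (region l d (0, 0)) (\<lambda>t. U t \<omega>))"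
    and W_prob: "\<And>v. v \<in> V d \<Longrightarrow> measure P {\<omega> \<in> space P. W v \<omega> = 0} = \<delta>"
    and \<delta>: "\<delta> > (real_of_int d - 1) / real_of_int d"
    and W_zero: "\<And>v \<omega> x. v \<in> V d \<Longrightarrow> \<omega> \<in> space P \<Longrightarrow> W v \<omega> = 0 \<Longrightarrow>
          x \<in> outer_bdry (region l d v) \<rightarrow>\<^sub>E E \<Longrightarrow>
          translate (offset l v) (block l (0, 0)) (block_map s l d v (\<lambda>t. U t \<omega>) x)
            = \<Phi> (translate (offset l v) (region l d (0, 0)) (\<lambda>t. U t \<omega>))"
  shows "uniformly_ergodic E K \<and>
    (\<exists>\<mu>. equilibrium_law E K \<mu>) \<and>
    (\<forall>\<mu> \<Lambda>. equilibrium_law E K \<mu> \<longrightarrow> finite \<Lambda> \<longrightarrow> union_of_blocks l d (inner_bdry \<Lambda>) \<longrightarrow>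
       (\<exists>Y \<in> P \<rightarrow>\<^sub>M PiM \<Lambda> (\<lambda>_. state_space E).
          (AE \<omega> in P.
             let B = D l d (\<lambda>v. W v \<omega>) \<Lambda>; u = (\<lambda>t. U t \<omega>)
             in finite B \<and> determined E s l d B u (\<Upsilon> E s l d B u) \<and>
                Y \<omega> = restrict (\<Upsilon> E s l d B u) \<Lambda>) \<and>
          distr P (PiM \<Lambda> (\<lambda>_. state_space E)) Y
            = distr \<mu> (PiM \<Lambda> (\<lambda>_. state_space E)) (\<lambda>y. restrict y \<Lambda>))) \<and>
    (\<exists>C. \<forall>\<Lambda>. finite \<Lambda> \<longrightarrow> union_of_blocks l d (inner_bdry \<Lambda>) \<longrightarrow>
       (AE \<omega> in P. finite (D l d (\<lambda>v. W v \<omega>) \<Lambda>)) \<and>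
       integrable P (\<lambda>\<omega>. real (card (D l d (\<lambda>v. W v \<omega>) \<Lambda>))) \<and>
       \<bar>(\<integral>\<omega>. real (card (D l d (\<lambda>v. W v \<omega>) \<Lambda>)) \<partial>P) - real (card \<Lambda>)\<bar>
         \<le> C * real (card (inner_bdry \<Lambda>)))"
proof -
  interpret coupled_field E K l d s P U W \<psi> \<Phi> \<delta>
    by (rule coupled_field.intro) (fact K l d coupling field_measurable P U_indep U_unif \<psi> \<Phi> W W_prob \<delta> W_zero)+
  show ?thesis
  proof (intro conjI)
    show "uniformly_ergodic E K"
      unfolding uniformly_ergodic_def using equilibrium_limit_law by blast
    show "\<exists>\<mu>. equilibrium_law E K \<mu>"
      using equilibrium_law by blast
  \<comment> \<open>The constant in the last claim is \<open>real_of_int l / (1 - \<theta>)\<close>,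
    the same for every \<Lambda>.\<close>
  qed (use equilibrium_on_region AE_finite_D expectation_card_D in blast)+
qed

end
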